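(* Let $\tau$ be any (possibly empty) proper face of $\mathrm{cone}(\mathcal A)$ and let $\omega\in\mathbb{R}^n$ be a generic weight vector. If $P_\tau+I_{\mathcal A}$ is an associated prime of $I_{\mathcal C_{\mathcal A}}$ (and hence embedded), then there exists a circuit-specific standard pair of $\mathrm{in}_\omega(I_{\mathcal C_{\mathcal A}})$ of type $\beta\subseteq[n]$ such that (1) $\beta\subseteq\tau$, (2) if $\sigma$ is a face of $\mathrm{cone}(\mathcal A)$ properly contained in $\tau$, then $\beta$ is not contained in $\sigma$, and (3) $|\beta|=\dim\mathrm{cone}(\mathcal A_\tau)$. Furthermore, there is a witness for the prime $P_\tau+I_{\mathcal A}$ whose leading term with respect to $\omega$ lies on such a circuit-specific standard pair.
   Context: Setting: $\mathcal A=\{\mathbf a_1,\dots,\mathbf a_n\}\subset\mathbb{Z}^d$ is an ordered vector configuration such that the $d\times n$ matrix $A=[\mathbf a_1\cdots\mathbf a_n]$ has rank $d$; $\mathcal L_{\mathcal A}=\{\mathbf u\in\mathbb{Z}^n: A\mathbf u=\mathbf 0\}$, and it is assumed that $\mathcal L_{\mathcal A}\cap\mathbb{N}^n=\{\mathbf 0\}$ ($\mathbb N$ contains $0$). $\mathbf k$ is an algebraically closed field, $\mathbf k[\mathbf x]=\mathbf k[x_1,\dots,x_n]$, $[n]=\{1,\dots,n\}$. For $\mathbf u\in\mathbb{Z}^n$: $\mathrm{supp}(\mathbf u)=\{i:u_i\ne0\}$, $\mathbf u^+_i=\max(u_i,0)$, $\mathbf u^-_i=\max(-u_i,0)$. Circuit: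 a non-zero vector $\mathbf c\in\mathcal L_{\mathcal A}$ whose entries have greatest common divisor one and such that no non-zero $\mathbf d\in\mathcal L_{\mathcal A}$ has $\mathrm{supp}(\mathbf d)\subsetneq\mathrm{supp}(\mathbf c)$. Circuit ideal: $I_{\mathcal C_{\mathcal A}}=\langle\mathbf x^{\mathbf c^+}-\mathbf x^{\mathbf c^-}:\mathbf c\text{ a circuit}\rangle$. Toric ideal: $I_{\mathcal A}=\langle\mathbf x^{\mathbf u^+}-\mathbf x^{\mathbf u^-}:\mathbf u\in\mathcal L_{\mathcal A}\rangle$. Faces: $\mathrm{cone}(\mathcal A)$ is the $d$-dimensional cone spanned by $\mathcal A$ in $\mathbb{R}^d$. A face $F$ of $\mathrm{cone}(\mathcal A)$ is recorded as the index set $\{j\in[n]:\mathbf a_j\in F\}$ (so $\emptyset$ is the apex $\{\mathbf 0\}$ and $[n]$ is the whole cone). For $\tau\subseteq[n]$, $\mathcal A_\tau=\{\mathbf a_j:j\in\tau\}$ and $P_\tau=\langle x_j:j\notin\tau\rangle$. A witness for an associated prime $P$ of an ideal $I$ is a polynomial $f$ with $(I:f)=P$. Initial ideals: for $\omega\in\mathbb{R}^n$, $\mathrm{in}_\omega(f)$ is the sum of the terms $c\,\mathbf x^{\mathbf u}$ of $f$ with $\omega\cdot\mathbf u$ maximal (the leading term of $f$ with respect to $\omega$ when it is a single term), and $\mathrm{in}_\omega(I)=\langle\mathrm{in}_\omega(f):f\in I\rangle$. $\omega$ is generic if $\mathrm{in}_\omega(I_{\mathcal A})$ and $\mathrm{in}_\omega(I_{\mathcal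 C_{\mathcal A}})$ are both monomial ideals. Standard pairs: a standard monomial of a monomial ideal $M$ is a monomial not in $M$. For a standard monomial $\mathbf x^{\mathbf u}$ and $\sigma\subseteq[n]$, $(\mathbf x^{\mathbf u},\sigma)$ is an admissible pair of $M$ if $\mathrm{supp}(\mathbf u)\cap\sigma=\emptyset$ and all monomials in $\mathbf x^{\mathbf u}\cdot\mathbf k[x_j:j\in\sigma]$ are standard. It is a standard pair if there is no other admissible pair $(\mathbf x^{\mathbf v},\tau)$ with $\mathbf v\le\mathbf u$ and $\mathrm{supp}(\mathbf u-\mathbf v)\cup\sigma\subseteq\tau$. The type of a pair $(\mathbf x^{\mathbf u},\sigma)$ is $\sigma$; a monomial lies on the pair if it belongs to $\mathbf x^{\mathbf u}\cdot\mathbf k[x_j:j\in\sigma]$. A circuit-specific standard pair (CSP) of $\mathrm{in}_\omega(I_{\mathcal C_{\mathcal A}})$ is a standard pair of $\mathrm{in}_\omega(I_{\mathcal C_{\mathcal A}})$ that is not a standard pair of $\mathrm{in}_\omega(I_{\mathcal A})$. *)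

theory Defs
  imports
    "HOL-Analysis.Analysis"
    "HOL-Library.Poly_Mapping"
    "HOL-Computational_Algebra.Polynomial"
begin

text \<open>The finite type \<open>'n\<close> plays the role of the index set \<open>{1,...,n}\<close>, and exponent vectors
  are elements of \<open>nat ^ 'n\<close>. The multiplication of \<^typ>\<open>'a \<Rightarrow>\<^sub>0 'b\<close> is convolution along the
  addition of \<open>'a\<close>, so this type is the polynomial ring over \<open>'k\<close> in variables indexed by \<open>'n\<close>.\<close>

type_synonym ('n, 'k) mpoly = "(nat ^ 'n) \<Rightarrow>\<^sub>0 'k"

definition supp :: "'a::zero ^ 'n \<Rightarrow> 'n set" where
  "supp u = {i. u $ i \<noteq> 0}"

definition xpow :: "nat ^ 'n \<Rightarrow> ('n::finite, 'k::comm_ring_1) mpoly" where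
  "xpow u = Poly_Mapping.single u 1"

definition var :: "'n \<Rightarrow> ('n::finite, 'k::comm_ring_1) mpoly" where
  "var j = xpow (axis j 1)"

text \<open>A commutative ring is a module over itself; its submodules (\<open>ideal.subspace\<close>) are the
  ideals, and \<open>ideal.span S\<close> is the ideal generated by \<open>S\<close>.\<close>

global_interpretation ideal: module "(*) :: 'a::comm_ring_1 \<Rightarrow> 'a \<Rightarrow> 'a"
  by standard (simp_all add: algebra_simps)

definition ideal_sum :: "'a::comm_ring_1 set \<Rightarrow> 'a set \<Rightarrow> 'a set" where
  "ideal_sum I J = {a + b | a b. a \<in> I \<and> b \<in> J}"

definition colon :: "'a::comm_ring_1 set \<Rightarrow> 'a \<Rightarrow> 'a set" where
  "colon I f = {g. g * f \<in> I}"

definition prime_ideal :: "'a::comm_ring_1 set \<Rightarrow> bool" where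
  "prime_ideal P \<longleftrightarrow> ideal.subspace P \<and> P \<noteq> UNIV \<and> (\<forall>a b. a * b \<in> P \<longrightarrow> a \<in> P \<or> b \<in> P)"

definition witness :: "'a::comm_ring_1 \<Rightarrow> 'a set \<Rightarrow> 'a set \<Rightarrow> bool" where
  "witness f P I \<longleftrightarrow> colon I f = P"

definition associated_prime :: "'a::comm_ring_1 set \<Rightarrow> 'a set \<Rightarrow> bool" where
  "associated_prime P I \<longleftrightarrow> prime_ideal P \<and> (\<exists>f. witness f P I)"

definition embedded_prime :: "'a::comm_ring_1 set \<Rightarrow> 'a set \<Rightarrow> bool" where
  "embedded_prime P I \<longleftrightarrow> associated_prime P I \<and> (\<exists>Q. prime_ideal Q \<and> I \<subseteq> Q \<and> Q \<subset> P)"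

text \<open>The configuration is the family of columns of an integer matrix.\<close>

definition config_lattice :: "int ^ 'n ^ 'd \<Rightarrow> (int ^ 'n) set" where
  "config_lattice A = {u. A *v u = 0}"

text \<open>Recall that \<^term>\<open>nat\<close> truncates negative integers to 0.\<close>

definition pos_part :: "int ^ 'n \<Rightarrow> nat ^ 'n" where
  "pos_part u = (\<chi> i. nat (u $ i))"

definition neg_part :: "int ^ 'n \<Rightarrow> nat ^ 'n" where
  "neg_part u = (\<chi> i. nat (- (u $ i)))"

definition binomial_of :: "int ^ 'n \<Rightarrow> ('n::finite, 'k::comm_ring_1) mpoly" where
  "binomial_of u = xpow (pos_part u) - xpow (neg_part u)"

definition circuit :: "int ^ 'n ^ 'd \<Rightarrow> int ^ 'n \<Rightarrow> bool" where
  "circuit A c \<longleftrightarrow> c \<in> config_lattice A \<and> c \<noteq> 0 \<and> Gcd (range (($) c)) = 1 \<and>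
     \<not> (\<exists>d \<in> config_lattice A. d \<noteq> 0 \<and> supp d \<subset> supp c)"

definition circuit_ideal :: "int ^ 'n ^ 'd \<Rightarrow> ('n::finite, 'k::comm_ring_1) mpoly set" where
  "circuit_ideal A = ideal.span {binomial_of c | c. circuit A c}"

definition toric_ideal :: "int ^ 'n ^ 'd \<Rightarrow> ('n::finite, 'k::comm_ring_1) mpoly set" where
  "toric_ideal A = ideal.span {binomial_of u | u. u \<in> config_lattice A}"

definition real_matrix :: "int ^ 'n ^ 'd \<Rightarrow> real ^ 'n ^ 'd" where
  "real_matrix A = map_matrix real_of_int A"

text \<open>The cone spanned by the columns with index in \<open>\<tau>\<close>; it is \<open>{0}\<close> for empty \<open>\<tau>\<close>.\<close>

definition cone_over :: "int ^ 'n ^ 'd \<Rightarrow> 'n set \<Rightarrow> (real ^ 'd) set" where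
  "cone_over A \<tau> = convex_cone hull ((\<lambda>j. column j (real_matrix A)) ` \<tau>)"

text \<open>Faces are recorded by index sets. The relation \<^term>\<open>(face_of)\<close> counts the empty set
  as a face, which is excluded here.\<close>

definition is_face :: "int ^ 'n ^ 'd \<Rightarrow> 'n set \<Rightarrow> bool" where
  "is_face A \<tau> \<longleftrightarrow>
     (\<exists>F. F face_of cone_over A UNIV \<and> F \<noteq> {} \<and> \<tau> = {j. column j (real_matrix A) \<in> F})"

definition coord_prime :: "'n set \<Rightarrow> ('n::finite, 'k::comm_ring_1) mpoly set" where
  "coord_prime \<tau> = ideal.span (var ` (- \<tau>))"

definition weight :: "real ^ 'n \<Rightarrow> nat ^ 'n \<Rightarrow> real" where
  "weight \<omega> u = \<omega> \<bullet> (\<chi> i. real (u $ i))"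

text \<open>Monomials of equal weight are not ordered further, so \<open>init_form \<omega> f\<close> can have several
  terms; it is the leading term of \<open>f\<close> when it has only one.\<close>

definition init_form ::
  "real ^ 'n \<Rightarrow> ('n::finite, 'k::comm_ring_1) mpoly \<Rightarrow> ('n, 'k) mpoly" where
  "init_form \<omega> f =
     (\<Sum>u \<in> {u \<in> Poly_Mapping.keys f. \<forall>v \<in> Poly_Mapping.keys f. weight \<omega> v \<le> weight \<omega> u}.
        Poly_Mapping.single u (Poly_Mapping.lookup f u))"

definition init_ideal ::
  "real ^ 'n \<Rightarrow> ('n::finite, 'k::comm_ring_1) mpoly set \<Rightarrow> ('n, 'k) mpoly set" where
  "init_ideal \<omega> I = ideal.span (init_form \<omega> ` I)"

definition monomial_ideal :: "('n::finite, 'k::comm_ring_1) mpoly set \<Rightarrow> bool" where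
  "monomial_ideal M \<longleftrightarrow> (\<exists>S. M = ideal.span (xpow ` S))"

text \<open>A pair \<open>(x^u, \<sigma>)\<close> is represented by \<open>(u, \<sigma>)\<close>.\<close>

definition lies_on :: "nat ^ 'n \<Rightarrow> (nat ^ 'n) \<times> 'n set \<Rightarrow> bool" where
  "lies_on v p \<longleftrightarrow> (\<exists>w. supp w \<subseteq> snd p \<and> v = fst p + w)"

definition admissible_pair ::
  "('n::finite, 'k::comm_ring_1) mpoly set \<Rightarrow> (nat ^ 'n) \<times> 'n set \<Rightarrow> bool" where
  "admissible_pair M p \<longleftrightarrow> xpow (fst p) \<notin> M \<and> supp (fst p) \<inter> snd p = {} \<and>
     (\<forall>v. lies_on v p \<longrightarrow> xpow v \<notin> M)"

text \<open>The difference \<open>fst p - fst q\<close> is not truncated, as \<open>fst q \<le> fst p\<close> componentwise.\<close>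

definition standard_pair ::
  "('n::finite, 'k::comm_ring_1) mpoly set \<Rightarrow> (nat ^ 'n) \<times> 'n set \<Rightarrow> bool" where
  "standard_pair M p \<longleftrightarrow> admissible_pair M p \<and>
     \<not> (\<exists>q. admissible_pair M q \<and> q \<noteq> p \<and> fst q \<le> fst p \<and>
            supp (fst p - fst q) \<union> snd p \<subseteq> snd q)"

text \<open>The last argument only fixes the coefficient field.\<close>

definition circuit_specific_pair ::
  "int ^ 'n ^ 'd \<Rightarrow> real ^ 'n \<Rightarrow> 'k::comm_ring_1 itself \<Rightarrow> (nat ^ 'n::finite) \<times> 'n set \<Rightarrow> bool"
where
  "circuit_specific_pair A \<omega> K p \<longleftrightarrow>
     standard_pair (init_ideal \<omega> (circuit_ideal A :: ('n, 'k) mpoly set)) p \<and>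
     \<not> standard_pair (init_ideal \<omega> (toric_ideal A :: ('n, 'k) mpoly set)) p"

definition type_spans_face :: "int ^ 'n ^ 'd \<Rightarrow> 'n set \<Rightarrow> 'n set \<Rightarrow> bool" where
  "type_spans_face A \<tau> \<beta> \<longleftrightarrow> \<beta> \<subseteq> \<tau> \<and>
     (\<forall>\<sigma>. is_face A \<sigma> \<and> \<sigma> \<subset> \<tau> \<longrightarrow> \<not> \<beta> \<subseteq> \<sigma>) \<and>
     int (card \<beta>) = aff_dim (cone_over A \<tau>)"

end

theory Submission
  imports Defs
begin

text \<open>
  Let \<open>f\<close> be a witness for the prime \<open>P = P\<^sub>\<tau> + I\<^sub>A\<close> of the circuit ideal \<open>I\<^sub>C\<close>. Three operations produce
  further witnesses: taking a suitable homogeneous component (for the grading in which the columns of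
  \<open>A\<close> are the degrees of the variables), multiplying by an element outside \<open>P\<close>, such as a monomial
  in the variables of \<open>\<tau>\<close>, and adding elements of \<open>I\<^sub>C\<close>. By the last one, the leading monomials
  may be assumed standard for the initial ideal of \<open>I\<^sub>C\<close> (\<open>normal_form\<close>).

  Consider a standard pair \<open>(u, \<beta>)\<close> on which a leading monomial of such a reduced witness lies. For
  \<open>j \<notin> \<tau>\<close> the variable \<open>x\<^sub>j\<close> is in \<open>P\<close> and multiplies the witness into \<open>I\<^sub>C\<close>, so it multiplies the
  leading monomial into the initial ideal; hence \<open>\<beta> \<subseteq> \<tau>\<close>. Since \<open>I\<^sub>A\<close> is prime and does not
  contain \<open>x\<^sub>j\<close>, the witness is in \<open>I\<^sub>A\<close>, so its leading monomials are nonstandard for \<open>I\<^sub>A\<close> and the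
  pair is circuit-specific. The columns in \<open>\<beta>\<close> are independent, because the binomial of a circuit
  supported in \<open>\<beta>\<close> would contribute a monomial in the directions of \<open>\<beta>\<close> to the initial ideal.

  It remains to arrange that the columns in \<open>\<beta>\<close> span the same space as those in \<open>\<tau>\<close>, which gives
  the dimension and excludes smaller faces (\<open>type_spans_faceI\<close>). Multiply \<open>f\<close> by the
  monomials \<open>x^(m t)\<close>, where \<open>m t\<close> runs through a moment curve in the coordinates of \<open>\<tau>\<close>, and reduce.
  A sequence of leading exponents has a subsequence in which each coordinate is
  eventually constant or tends to infinity; the unbounded coordinates \<open>\<beta>\<^sub>0\<close> are the type of an admissible pair,
  and so contained in the type of a standard pair that covers the tail of the subsequence
  (\<open>unbounded_coordinates_admissible\<close>). The degrees of the subsequence eventually stay in a translate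
  of the span of the columns in \<open>\<beta>\<^sub>0\<close>. They are also translates of the degrees of points on the moment curve,
  infinitely many of which do not fit into a translate of a proper subspace of the span of the columns
  in \<open>\<tau>\<close> (\<open>moment_exponents_span\<close>). So the columns in \<open>\<beta>\<^sub>0\<close> already span. Hence it
  is impossible that for every \<open>t\<close> some leading exponent lies on no pair of the required kind.
\<close>

section \<open>Terms and coefficients\<close>

lemma poly_mapping_sum_singles:
  "f = (\<Sum>u\<in>Poly_Mapping.keys f. Poly_Mapping.single u (Poly_Mapping.lookup f u))"
  by (rule poly_mapping_eqI)
     (auto simp: lookup_sum lookup_single when_def in_keys_iff)

lemma lookup_single_mult:
  fixes f :: "'a::cancel_comm_monoid_add \<Rightarrow>\<^sub>0 'k::comm_ring_1"
  shows "Poly_Mapping.lookup (Poly_Mapping.single a c * f) (a + u) = c * Poly_Mapping.lookup f u"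
proof -
  have "Poly_Mapping.lookup (Poly_Mapping.single a c * f) (a + u) =
     (\<Sum>v\<in>Poly_Mapping.keys f. Poly_Mapping.lookup (Poly_Mapping.single (a + v) (c * Poly_Mapping.lookup f v)) (a + u))"
    by (subst poly_mapping_sum_singles[of f])
       (simp only: sum_distrib_left mult_single lookup_sum)
  also have "\<dots> = (\<Sum>v\<in>Poly_Mapping.keys f. if v = u then c * Poly_Mapping.lookup f v else 0)"
    by (intro sum.cong) (auto simp: lookup_single when_def)
  also have "\<dots> = c * Poly_Mapping.lookup f u"
    by (auto simp: in_keys_iff)
  finally show ?thesis .
qed

lemma keys_single_mult_subset:
  fixes f :: "'a::cancel_comm_monoid_add \<Rightarrow>\<^sub>0 'k::comm_ring_1"
  shows "Poly_Mapping.keys (Poly_Mapping.single a c * f) \<subseteq> (+) a ` Poly_Mapping.keys f"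
  using keys_mult[of "Poly_Mapping.single a c" f] by (force split: if_splits)

lemma keys_xpow_mult:
  "Poly_Mapping.keys (xpow a * f) = (+) a ` Poly_Mapping.keys f"
  unfolding xpow_def using keys_single_mult_subset[of a 1 f]
  by (auto simp: in_keys_iff lookup_single_mult)

lemma lookup_xpow: "Poly_Mapping.lookup (xpow a) u = (1 when a = u)"
  by (simp add: xpow_def lookup_single)

lemma xpow_add: "xpow (a + b) = xpow a * xpow b"
  by (simp add: xpow_def mult_single)

lemma ideal_mult_closedI:
  fixes S :: "('n::finite, 'k::comm_ring_1) mpoly set"
  assumes "0 \<in> S" "\<And>f g. f \<in> S \<Longrightarrow> g \<in> S \<Longrightarrow> f + g \<in> S"
    and "\<And>a c. Poly_Mapping.single a c * f \<in> S"
  shows "r * f \<in> S"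
proof -
  have "(\<Sum>u\<in>B. Poly_Mapping.single u (Poly_Mapping.lookup r u) * f) \<in> S" if "finite B" for B
    using that by (induction B) (use assms in auto)
  then have "(\<Sum>u\<in>Poly_Mapping.keys r. Poly_Mapping.single u (Poly_Mapping.lookup r u)) * f \<in> S"
    by (simp add: sum_distrib_right)
  then show ?thesis by (simp flip: poly_mapping_sum_singles)
qed

section \<open>Monomial ideals and initial forms\<close>

text \<open>A monomial of a polynomial in the ideal is a multiple of a generator: this property of
  polynomials is stable under sums and under multiplication by terms, so it passes from the
  generators to the whole ideal.\<close>

lemma monomial_ideal_iff_keys:
  fixes M :: "('n::finite, 'k::comm_ring_1) mpoly set"
  assumes "monomial_ideal M"
  shows "p \<in> M \<longleftrightarrow> (\<forall>u\<in>Poly_Mapping.keys p. xpow u \<in> M)"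
proof -
  obtain S where M: "M = ideal.span (xpow ` S)" using assms by (auto simp: monomial_ideal_def)
  define T where "T = {p :: ('n,'k) mpoly. \<forall>u\<in>Poly_Mapping.keys p. \<exists>s\<in>S. \<exists>w. u = s + w}"
  have add: "f + g \<in> T" if "f \<in> T" "g \<in> T" for f g
    using that keys_add[of f g] by (force simp: T_def)
  have mult: "r * xpow s \<in> T" if "s \<in> S" for r s
  proof (rule ideal_mult_closedI)
    show "Poly_Mapping.single a c * xpow s \<in> T" for a c
    proof -
      have "a + s = s + a" by (rule add.commute)
      then show ?thesis using that by (auto simp: T_def xpow_def mult_single)
    qed
    show "0 \<in> T" by (simp add: T_def)
  qed (rule add)
  have T: "p \<in> T" if "p \<in> M" for p
    using that unfolding M
  proof (induction rule: ideal.span_induct_alt)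
    case base then show ?case by (simp add: T_def)
  next
    case (step r x y) then show ?case using mult add by auto
  qed
  have 1: "xpow u \<in> M" if pM: "p \<in> M" and uk: "u \<in> Poly_Mapping.keys p" for p u
  proof -
    obtain s w where s: "s \<in> S" "u = s + w" using T[OF pM] uk unfolding T_def by blast
    show ?thesis unfolding M s(2) xpow_add
      by (subst mult.commute) (intro ideal.span_scale ideal.span_base imageI s(1))
  qed
  have "p \<in> M" if assms2: "\<forall>u\<in>Poly_Mapping.keys p. xpow u \<in> M"
  proof -
    have "Poly_Mapping.single u (Poly_Mapping.lookup p u) \<in> M" if "u \<in> Poly_Mapping.keys p" for u
    proof -
      have "Poly_Mapping.single u (Poly_Mapping.lookup p u) = Poly_Mapping.single 0 (Poly_Mapping.lookup p u) * xpow u"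
        by (simp add: xpow_def mult_single)
      moreover have "xpow u \<in> M" using assms2 that by blast
      ultimately show ?thesis unfolding M by (simp only: ideal.span_scale)
    qed
    then show ?thesis
      unfolding M by (subst poly_mapping_sum_singles) (rule ideal.span_sum)
  qed
  with 1 show ?thesis by blast
qed

lemma lookup_init_form:
  "Poly_Mapping.lookup (init_form \<omega> f) u =
     (Poly_Mapping.lookup f u when (\<forall>v\<in>Poly_Mapping.keys f. weight \<omega> v \<le> weight \<omega> u))"
  unfolding init_form_def
  by (auto simp: lookup_sum lookup_single when_def in_keys_iff)

lemma keys_init_form:
  "Poly_Mapping.keys (init_form \<omega> f) =
     {u \<in> Poly_Mapping.keys f. \<forall>v\<in>Poly_Mapping.keys f. weight \<omega> v \<le> weight \<omega> u}"
  by (auto simp: in_keys_iff lookup_init_form)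

lemma keys_init_form_nonempty:
  fixes f :: "('n::finite, 'k::comm_ring_1) mpoly"
  assumes "f \<noteq> 0" shows "Poly_Mapping.keys (init_form \<omega> f) \<noteq> {}"
proof -
  have "Poly_Mapping.keys f \<noteq> {}"
    using assms poly_mapping_sum_singles[of f] by force
  then obtain u where "u \<in> Poly_Mapping.keys f" "weight \<omega> u = Max (weight \<omega> ` Poly_Mapping.keys f)"
    using Max_in[of "weight \<omega> ` Poly_Mapping.keys f"] by fastforce
  then show ?thesis by (auto simp: keys_init_form)
qed

lemma weight_add: "weight \<omega> (u + v) = weight \<omega> u + weight \<omega> v"
  by (simp add: weight_def inner_vec_def sum.distrib algebra_simps)

lemma init_form_xpow_mult: "init_form \<omega> (xpow a * f) = xpow a * init_form \<omega> f"
proof (rule poly_mapping_eqI)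
  fix u
  show "Poly_Mapping.lookup (init_form \<omega> (xpow a * f)) u = Poly_Mapping.lookup (xpow a * init_form \<omega> f) u"
  proof (cases "\<exists>w. u = a + w")
    case True
    then obtain w where u: "u = a + w" by blast
    show ?thesis unfolding u lookup_init_form keys_xpow_mult
      by (auto simp: xpow_def lookup_single_mult lookup_init_form weight_add)
  next
    case False
    then have "u \<notin> Poly_Mapping.keys (xpow a * f)" "u \<notin> Poly_Mapping.keys (xpow a * init_form \<omega> f)"
      by (auto simp: keys_xpow_mult)
    then show ?thesis by (simp add: lookup_init_form in_keys_iff)
  qed
qed

section \<open>The grading by the configuration\<close>

text \<open>The column \<open>j\<close> of \<open>A\<close> is the degree of the variable \<open>x\<^sub>j\<close>. Monomials have equal degree exactly when
  their exponents differ by a lattice vector, so toric and circuit ideals are graded.\<close>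

definition config_degree :: "int ^ 'n ^ 'd \<Rightarrow> nat ^ 'n \<Rightarrow> int ^ 'd" where
  "config_degree A u = A *v (\<chi> i. int (u $ i))"

definition homog :: "int ^ 'n ^ 'd \<Rightarrow> int ^ 'd \<Rightarrow> ('n::finite, 'k::comm_ring_1) mpoly \<Rightarrow> bool" where
  "homog A b f \<longleftrightarrow> (\<forall>u\<in>Poly_Mapping.keys f. config_degree A u = b)"

definition homog_part :: "int ^ 'n ^ 'd \<Rightarrow> int ^ 'd \<Rightarrow> ('n::finite, 'k::comm_ring_1) mpoly \<Rightarrow> ('n, 'k) mpoly" where
  "homog_part A b = Poly_Mapping.mapp (\<lambda>u c. c when config_degree A u = b)"

lemma config_degree_add: "config_degree A (u + v) = config_degree A u + config_degree A v"
proof -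
  have "(\<chi> i. int ((u + v) $ i)) = (\<chi> i. int (u $ i)) + (\<chi> i. int (v $ i))"
    by (simp add: vec_eq_iff)
  then show ?thesis by (simp add: config_degree_def matrix_vector_right_distrib)
qed

lemma config_degree_eq_iff: "config_degree A u = config_degree A v \<longleftrightarrow> (\<chi> i. int (u $ i) - int (v $ i)) \<in> config_lattice A"
proof -
  have "(\<chi> i. int (u $ i) - int (v $ i)) = (\<chi> i. int (u $ i)) - (\<chi> i. int (v $ i))"
    by (simp add: vec_eq_iff)
  then show ?thesis by (simp add: config_degree_def config_lattice_def matrix_vector_mult_diff_distrib)
qed

lemma lookup_homog_part: "Poly_Mapping.lookup (homog_part A b f) u = (Poly_Mapping.lookup f u when config_degree A u = b)"
  by (auto simp: homog_part_def lookup_mapp when_def in_keys_iff)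

lemma keys_homog_part: "Poly_Mapping.keys (homog_part A b f) = {u \<in> Poly_Mapping.keys f. config_degree A u = b}"
  by (auto simp: in_keys_iff lookup_homog_part)

lemma homog_part_add: "homog_part A b (f + g) = homog_part A b f + homog_part A b g"
  by (rule poly_mapping_eqI) (simp add: lookup_homog_part lookup_add when_def)

lemma homog_part_zero: "homog_part A b 0 = 0"
  by (rule poly_mapping_eqI) (simp add: lookup_homog_part)

lemma homog_part_homog: "homog A b (homog_part A b f)"
  by (simp add: homog_def keys_homog_part)

lemma sum_homog_part: "f = (\<Sum>b\<in>config_degree A ` Poly_Mapping.keys f. homog_part A b f)"
proof (rule poly_mapping_eqI)
  fix u
  have "(\<Sum>b\<in>config_degree A ` Poly_Mapping.keys f. Poly_Mapping.lookup f u when config_degree A u = b) = Poly_Mapping.lookup f u"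
    by (auto simp: when_def in_keys_iff)
  then show "Poly_Mapping.lookup f u = Poly_Mapping.lookup (\<Sum>b\<in>config_degree A ` Poly_Mapping.keys f. homog_part A b f) u"
    by (simp add: lookup_sum lookup_homog_part)
qed

lemma homog_mult:
  assumes "homog A b f" "homog A c g" shows "homog A (b + c) (f * g)"
  using assms keys_mult[of f g] by (fastforce simp: homog_def config_degree_add)

lemma homog_single: "homog A (config_degree A u) (Poly_Mapping.single u c)"
  by (simp add: homog_def)

lemma homog_part_of_homog: "homog A b f \<Longrightarrow> homog_part A c f = (f when b = c)"
  by (rule poly_mapping_eqI)
     (auto simp: lookup_homog_part homog_def when_def not_in_keys_iff_lookup_eq_zero[symmetric])

text \<open>Degrees live in a group, so a factor of known degree \<open>e\<close> shifts all components by \<open>e\<close>.\<close>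

lemma homog_part_mult:
  assumes "homog A e g"
  shows "homog_part A b (r * g) = homog_part A (b - e) r * g"
proof -
  have *: "homog_part A b (Poly_Mapping.single a c * g) = homog_part A (b - e) (Poly_Mapping.single a c) * g" for a c
    by (auto simp: homog_part_of_homog[OF homog_mult[OF homog_single assms]]
        homog_part_of_homog[OF homog_single] when_def)
  have "homog_part A b ((\<Sum>u\<in>B. Poly_Mapping.single u (Poly_Mapping.lookup r u)) * g) =
    homog_part A (b - e) (\<Sum>u\<in>B. Poly_Mapping.single u (Poly_Mapping.lookup r u)) * g" if "finite B" for B
    using that by induction (simp_all add: homog_part_zero homog_part_add * distrib_right)
  from this[of "Poly_Mapping.keys r"] show ?thesis by (simp flip: poly_mapping_sum_singles)
qed

definition graded :: "int ^ 'n ^ 'd \<Rightarrow> ('n::finite, 'k::comm_ring_1) mpoly set \<Rightarrow> bool" where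
  "graded A I \<longleftrightarrow> (\<forall>f\<in>I. \<forall>b. homog_part A b f \<in> I)"

lemma graded_span:
  assumes "\<And>g. g \<in> G \<Longrightarrow> \<exists>e. homog A e g"
  shows "graded A (ideal.span G)"
proof -
  have "homog_part A b f \<in> ideal.span G" if "f \<in> ideal.span G" for b f
    using that
  proof (induction rule: ideal.span_induct_alt)
    case base then show ?case by (simp add: homog_part_zero ideal.span_zero)
  next
    case (step r x y)
    then obtain e where "homog A e x" using assms by blast
    then show ?case using step
      by (simp add: homog_part_add homog_part_mult ideal.span_add ideal.span_scale ideal.span_base)
  qed
  then show ?thesis by (auto simp: graded_def)
qed

lemma graded_ideal_sum:
  assumes "graded A I" "graded A J" shows "graded A (ideal_sum I J)"
  using assms by (fastforce simp: graded_def ideal_sum_def homog_part_add)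

lemma homog_xpow: "homog A (config_degree A u) (xpow u)"
  by (simp add: homog_def xpow_def)

lemma homog_diff: "homog A b f \<Longrightarrow> homog A b g \<Longrightarrow> homog A b (f - g)"
  using keys_diff[of f g] by (auto simp: homog_def)

lemma config_degree_parts:
  assumes "c \<in> config_lattice A" shows "config_degree A (pos_part c) = config_degree A (neg_part c)"
proof -
  have "(\<chi> i. int (pos_part c $ i) - int (neg_part c $ i)) = c"
    by (simp add: vec_eq_iff pos_part_def neg_part_def)
  then show ?thesis using assms by (simp add: config_degree_eq_iff)
qed

lemma homog_binomial: "c \<in> config_lattice A \<Longrightarrow> \<exists>e. homog A e (binomial_of c)"
  unfolding binomial_of_def by (metis config_degree_parts homog_diff homog_xpow)

lemma graded_toric_ideal: "graded A (toric_ideal A)"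
  unfolding toric_ideal_def by (rule graded_span) (use homog_binomial in blast)

lemma graded_circuit_ideal: "graded A (circuit_ideal A)"
  unfolding circuit_ideal_def by (rule graded_span) (use homog_binomial in \<open>auto simp: circuit_def\<close>)

lemma graded_coord_prime: "graded A (coord_prime \<tau>)"
  unfolding coord_prime_def by (rule graded_span) (auto simp: var_def intro: homog_xpow)

section \<open>Homogeneous witnesses\<close>

text \<open>If \<open>g\<close> is homogeneous, then \<open>g\<close> times a component of \<open>f\<close> is a component of \<open>g f\<close>. The
  general case is the sum over the components of \<open>g\<close>, which lie in \<open>P\<close> because \<open>P\<close> is graded.\<close>

lemma homog_part_in_colon:
  assumes I: "ideal.subspace I" "graded A I" and P: "graded A P" and w: "witness f P I"
    and g: "g \<in> P"
  shows "g * homog_part A b f \<in> I"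
proof -
  have gf: "homog_part A c g * f \<in> I" for c
    using g P w by (auto simp: graded_def witness_def colon_def)
  have "homog_part A c g * homog_part A b f \<in> I" for c
  proof -
    have "homog_part A (b + c) (f * homog_part A c g) \<in> I"
      using gf I(2) by (simp add: graded_def mult.commute)
    then show ?thesis by (simp add: homog_part_mult[OF homog_part_homog] mult.commute)
  qed
  then have "(\<Sum>c\<in>config_degree A ` Poly_Mapping.keys g. homog_part A c g) * homog_part A b f \<in> I"
    unfolding sum_distrib_right by (intro ideal.subspace_sum[OF I(1)])
  then show ?thesis by (simp flip: sum_homog_part)
qed

lemma prime_ideal_prodD:
  assumes "prime_ideal P" "finite B" "prod g B \<in> P"
  shows "\<exists>b\<in>B. g b \<in> P"
  using assms(2,3)
proof (induction B)
  case empty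
  then have "r \<in> P" for r
    using ideal.subspace_scale[of P 1 r] assms(1) by (auto simp: prime_ideal_def)
  then show ?case using assms(1) by (auto simp: prime_ideal_def)
next
  case (insert x F) then show ?case using assms(1) by (auto simp: prime_ideal_def)
qed

text \<open>Every component of \<open>f\<close> is annihilated by \<open>P\<close> modulo \<open>I\<close>. If each of these finitely many
  components were annihilated by something outside \<open>P\<close> too, the product of those elements would
  annihilate \<open>f\<close>, hence lie in \<open>P\<close>, against primality.\<close>

lemma homogeneous_witness:
  assumes I: "ideal.subspace I" "graded A I" and P: "graded A P" "prime_ideal P" and w: "witness f P I"
  shows "\<exists>b. witness (homog_part A b f) P I"
proof (rule ccontr)
  assume "\<nexists>b. witness (homog_part A b f) P I"
  then have "\<forall>b. \<exists>g. g * homog_part A b f \<in> I \<and> g \<notin> P"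
    using homog_part_in_colon[OF I P(1) w] unfolding witness_def colon_def by blast
  from choice[OF this] obtain g where "\<forall>b. g b * homog_part A b f \<in> I \<and> g b \<notin> P" ..
  then have g: "g b * homog_part A b f \<in> I" "g b \<notin> P" for b by simp_all
  let ?B = "config_degree A ` Poly_Mapping.keys f"
  have "prod g ?B * homog_part A b f \<in> I" if "b \<in> ?B" for b
  proof -
    have "prod g ?B * homog_part A b f = prod g (?B - {b}) * (g b * homog_part A b f)"
      using prod.remove[OF _ that, of g] by (simp only: finite_imageI finite_keys mult_ac)
    then show ?thesis using g(1) by (simp only: ideal.subspace_scale[OF I(1)])
  qed
  then have "prod g ?B * (\<Sum>b\<in>?B. homog_part A b f) \<in> I"
    unfolding sum_distrib_left by (intro ideal.subspace_sum[OF I(1)])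
  then have "prod g ?B * f \<in> I" by (simp flip: sum_homog_part)
  then have "prod g ?B \<in> P" using w by (auto simp: witness_def colon_def)
  then have "\<exists>b\<in>?B. g b \<in> P" by (intro prime_ideal_prodD[OF P(2)]) auto
  then show False using g(2) by simp
qed

lemma witness_congI:
  assumes "ideal.subspace I" "witness f P I" "f - g \<in> I" shows "witness g P I"
proof -
  have "r * g \<in> I \<longleftrightarrow> r * f \<in> I" for r
  proof -
    have "r * (f - g) \<in> I" using assms(1,3) ideal.subspace_scale by blast
    then show ?thesis
      using ideal.subspace_diff[OF assms(1), of "r * f" "r * (f - g)"]
        ideal.subspace_add[OF assms(1), of "r * g" "r * (f - g)"] by (auto simp: algebra_simps)
  qed
  then show ?thesis using assms(2) by (auto simp: witness_def colon_def)
qed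

lemma witness_mult:
  assumes "prime_ideal P" "witness f P I" "m \<notin> P" shows "witness (m * f) P I"
proof -
  have colon: "r * f \<in> I \<longleftrightarrow> r \<in> P" for r
    using assms(2) unfolding witness_def colon_def by blast
  have "r * (m * f) \<in> I \<longleftrightarrow> r * m \<in> P" for r
    using colon[of "r * m"] by (simp only: mult.assoc)
  moreover have "r * m \<in> P \<longleftrightarrow> r \<in> P" for r
  proof
    assume "r \<in> P"
    then have "m * r \<in> P" using assms(1) by (simp add: prime_ideal_def ideal.subspace_scale)
    then show "r * m \<in> P" by (simp only: mult.commute)
  qed (use assms(1,3) in \<open>auto simp: prime_ideal_def\<close>)
  ultimately show ?thesis by (simp add: witness_def colon_def)
qed

section \<open>Normal forms modulo an initial ideal\<close>

text \<open>Dickson's lemma for sequences: pass to a monotone subsequence in one coordinate after the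
  other. A decreasing sequence of naturals is eventually constant, so increasing can be achieved.\<close>

lemma monotone_subsequence:
  fixes v :: "nat \<Rightarrow> nat ^ 'n::finite"
  shows "\<exists>g. strict_mono g \<and> (\<forall>i. incseq (\<lambda>k. v (g k) $ i))"
proof -
  have nat_case: "\<exists>g. strict_mono g \<and> incseq (\<lambda>k. s (g k))" for s :: "nat \<Rightarrow> nat"
  proof -
    obtain g where g: "strict_mono g" "monoseq (\<lambda>k. s (g k))" using seq_monosub by blast
    show ?thesis
    proof (cases "incseq (\<lambda>k. s (g k))")
      case False
      then have "decseq (\<lambda>k. s (g k))" using g(2) by (simp add: monoseq_iff)
      let ?m = "Inf (range (\<lambda>k. s (g k)))"
      have "?m \<in> range (\<lambda>k. s (g k))" by (rule Inf_nat_def1) simp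
      then obtain K where K: "s (g K) = ?m" by auto
      have "s (g k) = ?m" if "k \<ge> K" for k
        using decseqD[OF \<open>decseq _\<close> that] K cInf_lower[of "s (g k)" "range (\<lambda>k. s (g k))"] by auto
      then have "incseq (\<lambda>k. s (g (k + K)))" by (simp add: incseq_def)
      moreover have "strict_mono (\<lambda>k. g (k + K))" using g(1) by (simp add: strict_mono_def)
      ultimately show ?thesis by blast
    qed (use g in blast)
  qed
  have "\<exists>g. strict_mono g \<and> (\<forall>i\<in>B. incseq (\<lambda>k. v (g k) $ i))" if "finite B" for B
    using that
  proof (induction B)
    case empty then show ?case using strict_mono_id by auto
  next
    case (insert i B)
    then obtain g where g: "strict_mono g" "\<forall>i\<in>B. incseq (\<lambda>k. v (g k) $ i)" by blast
    obtain h where h: "strict_mono h" "incseq (\<lambda>k. v (g (h k)) $ i)"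
      using nat_case[of "\<lambda>k. v (g k) $ i"] by blast
    have "incseq (\<lambda>k. v (g (h k)) $ j)" if "j \<in> B" for j
      using g(2) that h(1) by (auto simp: incseq_def strict_mono_less_eq)
    then show ?case using h g(1) strict_mono_o[OF g(1) h(1)] by (intro exI[of _ "\<lambda>k. g (h k)"]) (auto simp: comp_def)
  qed
  from this[of UNIV] show ?thesis by simp
qed

text \<open>An infinite fibre would contain two distinct comparable exponents, whose difference is a
  nonzero nonnegative lattice vector.\<close>

lemma finite_fibre:
  assumes "config_lattice A \<inter> {u. \<forall>i. 0 \<le> u $ i} = {0}"
  shows "finite {u. config_degree A u = b}"
proof (rule ccontr)
  assume "infinite {u. config_degree A u = b}"
  then obtain v :: "nat \<Rightarrow> _" where v: "inj v" "range v \<subseteq> {u. config_degree A u = b}"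
    using infinite_countable_subset by blast
  obtain g where g: "strict_mono g" "\<forall>i. incseq (\<lambda>k. v (g k) $ i)" using monotone_subsequence by blast
  define d where "d = (\<chi> i. int (v (g 1) $ i) - int (v (g 0) $ i))"
  have "config_degree A (v k) = b" for k using v(2) by (auto simp: subset_iff)
  then have "config_degree A (v (g 1)) = config_degree A (v (g 0))" by simp
  then have "d \<in> config_lattice A" unfolding d_def by (simp only: config_degree_eq_iff)
  moreover have "\<forall>i. 0 \<le> d $ i" using g(2) by (simp add: d_def incseq_def)
  ultimately have "d \<in> config_lattice A \<inter> {u. \<forall>i. 0 \<le> u $ i}" by simp
  then have "d = 0" unfolding assms by simp
  then have "v (g 1) = v (g 0)" by (simp add: d_def vec_eq_iff)
  then have "g 1 = g 0" using v(1) by (simp add: inj_eq)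
  then show False using g(1) by (simp add: strict_mono_eq)
qed

text \<open>Membership in an initial ideal is certified in each degree \<open>b\<close> and weight \<open>w\<close> separately: the part
  of \<open>p\<close> of this degree and weight is the top part of a homogeneous element of \<open>I\<close> of weight at
  most \<open>w\<close>. This statement is additive in \<open>p\<close>, so it only has to be checked on terms times
  initial forms.\<close>

lemma init_ideal_representative:
  assumes I: "ideal.subspace I" "graded A I" and "p \<in> init_ideal \<omega> I"
  shows "\<exists>h\<in>I. homog A b h \<and> (\<forall>u\<in>Poly_Mapping.keys h. weight \<omega> u \<le> w) \<and>
    (\<forall>u. config_degree A u = b \<and> weight \<omega> u = w \<longrightarrow> Poly_Mapping.lookup h u = Poly_Mapping.lookup p u)"
    (is "?R p")
proof -
  have zero: "?R 0" using ideal.subspace_0[OF I(1)] by (intro bexI[of _ 0]) (auto simp: homog_def)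
  have add: "?R (p + q)" if p: "?R p" and q: "?R q" for p q
  proof -
    obtain g h where "g \<in> I" "h \<in> I" "homog A b g" "homog A b h"
      "\<forall>u\<in>Poly_Mapping.keys g. weight \<omega> u \<le> w" "\<forall>u\<in>Poly_Mapping.keys h. weight \<omega> u \<le> w"
      "\<forall>u. config_degree A u = b \<and> weight \<omega> u = w \<longrightarrow> Poly_Mapping.lookup g u = Poly_Mapping.lookup p u"
      "\<forall>u. config_degree A u = b \<and> weight \<omega> u = w \<longrightarrow> Poly_Mapping.lookup h u = Poly_Mapping.lookup q u"
      using p q by blast
    then show ?thesis
      using keys_add[of g h] ideal.subspace_add[OF I(1)]
      by (intro bexI[of _ "g + h"]) (auto simp: homog_def lookup_add subset_iff)
  qed
  have single: "?R (Poly_Mapping.single a c * init_form \<omega> g)" if g: "g \<in> I" for a c g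
  proof -
    let ?p = "Poly_Mapping.single a c * init_form \<omega> g"
    have key: "\<exists>v. u = a + v \<and> v \<in> Poly_Mapping.keys (init_form \<omega> g)" if "u \<in> Poly_Mapping.keys ?p" for u
      using keys_single_mult_subset that by blast
    show ?thesis
    proof (cases "\<exists>u. u \<in> Poly_Mapping.keys ?p \<and> weight \<omega> u = w")
      case True
      then obtain v where v: "v \<in> Poly_Mapping.keys (init_form \<omega> g)" "weight \<omega> (a + v) = w"
        using key by metis
      have top: "weight \<omega> (a + u) \<le> w" if "u \<in> Poly_Mapping.keys g" for u
        using v that by (auto simp: keys_init_form weight_add)
      let ?h = "homog_part A b (Poly_Mapping.single a c * g)"
      have "?h \<in> I" using I g by (auto simp: graded_def ideal.subspace_scale)
      moreover have "weight \<omega> u \<le> w" if "u \<in> Poly_Mapping.keys ?h" for u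
        using that keys_single_mult_subset[of a c g] top by (auto simp: keys_homog_part)
      moreover have "Poly_Mapping.lookup ?h u = Poly_Mapping.lookup ?p u" if "config_degree A u = b" "weight \<omega> u = w" for u
      proof (cases "\<exists>x. u = a + x")
        case x: True
        then obtain x where u: "u = a + x" by blast
        have "Poly_Mapping.lookup (init_form \<omega> g) x = Poly_Mapping.lookup g x"
        proof (cases "x \<in> Poly_Mapping.keys g")
          case True
          have "weight \<omega> y \<le> weight \<omega> x" if "y \<in> Poly_Mapping.keys g" for y
            using top[OF that] \<open>weight \<omega> u = w\<close> by (simp add: u weight_add)
          then show ?thesis by (simp add: lookup_init_form)
        qed (simp add: lookup_init_form in_keys_iff)
        then show ?thesis using that by (simp add: lookup_homog_part u lookup_single_mult)
      next
        case False
        then have "u \<notin> Poly_Mapping.keys ?p" "u \<notin> Poly_Mapping.keys (Poly_Mapping.single a c * g)"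
          using keys_single_mult_subset by blast+
        then show ?thesis by (simp add: lookup_homog_part in_keys_iff)
      qed
      ultimately show ?thesis using homog_part_homog by blast
    next
      case False
      then have "\<forall>u. config_degree A u = b \<and> weight \<omega> u = w \<longrightarrow> Poly_Mapping.lookup ?p u = 0"
        by (auto simp: in_keys_iff)
      then show ?thesis
        using ideal.subspace_0[OF I(1)] by (intro bexI[of _ 0]) (auto simp: homog_def)
    qed
  qed
  have "?R p" if "p \<in> ideal.span (init_form \<omega> ` I)" for p
    using that
  proof (induction rule: ideal.span_induct_alt)
    case base show ?case by (rule zero)
  next
    case (step r x y)
    then obtain g where g: "g \<in> I" "x = init_form \<omega> g" by blast
    have "r * x \<in> {p. ?R p}"
      by (rule ideal_mult_closedI) (use zero add single[OF g(1)] in \<open>simp_all add: g(2)\<close>)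
    then show ?case using add step by blast
  qed
  then show ?thesis using assms(3) by (simp add: init_ideal_def)
qed

text \<open>The reduction of Groebner theory, as far as the initial form is concerned. Weights may be
  negative; the reduction stops because only finitely many monomials have the degree \<open>b\<close>.\<close>

lemma normal_form:
  assumes I: "ideal.subspace I" "graded A I"
    and fin: "finite {u. config_degree A u = b}" and f: "homog A b f"
  shows "\<exists>g. f - g \<in> I \<and> homog A b g \<and> (\<forall>v\<in>Poly_Mapping.keys (init_form \<omega> g). xpow v \<notin> init_ideal \<omega> I)"
proof -
  \<comment> \<open>The exponents that a reduction of \<open>g\<close> may still reach; a reduction step strictly shrinks this set.\<close>
  define D where "D g = Poly_Mapping.keys g \<union> {u. config_degree A u = b \<and> (\<exists>v\<in>Poly_Mapping.keys g. weight \<omega> u < weight \<omega> v)}"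
    for g :: "('a, 'b) mpoly"
  have D_sub: "D g \<subseteq> {u. config_degree A u = b}" if "homog A b g" for g
    using that by (auto simp: D_def homog_def)
  obtain g where g: "f - g \<in> I" "homog A b g"
    and min: "\<And>h. f - h \<in> I \<Longrightarrow> homog A b h \<Longrightarrow> card (D g) \<le> card (D h)"
    using ex_has_least_nat[of "\<lambda>g. f - g \<in> I \<and> homog A b g" f "\<lambda>g. card (D g)"]
      f ideal.subspace_0[OF I(1)] by auto
  have "xpow v \<notin> init_ideal \<omega> I" if v: "v \<in> Poly_Mapping.keys (init_form \<omega> g)" for v
  proof
    assume "xpow v \<in> init_ideal \<omega> I"
    then obtain h where h: "h \<in> I" "homog A b h" "\<forall>u\<in>Poly_Mapping.keys h. weight \<omega> u \<le> weight \<omega> v"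
      "\<And>u. config_degree A u = b \<Longrightarrow> weight \<omega> u = weight \<omega> v \<Longrightarrow> Poly_Mapping.lookup h u = Poly_Mapping.lookup (xpow v) u"
      using init_ideal_representative[OF I, of "xpow v" \<omega> b "weight \<omega> v"] by auto
    define c where "c = Poly_Mapping.lookup g v"
    define g' where "g' = g - Poly_Mapping.single 0 c * h"
    have lk: "Poly_Mapping.lookup g' u = Poly_Mapping.lookup g u - c * Poly_Mapping.lookup h u" for u
      using lookup_single_mult[of 0 c h u] by (simp add: g'_def lookup_minus)
    have vg: "v \<in> Poly_Mapping.keys g" "config_degree A v = b" and vtop: "\<And>u. u \<in> Poly_Mapping.keys g \<Longrightarrow> weight \<omega> u \<le> weight \<omega> v"
      using v g(2) by (auto simp: keys_init_form homog_def)
    have hg': "homog A b g'"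
      using g(2) h(2) by (auto simp: homog_def in_keys_iff lk)
    have "f - g' = (f - g) + Poly_Mapping.single 0 c * h" by (simp add: g'_def)
    then have fg': "f - g' \<in> I"
      by (simp only: ideal.subspace_add[OF I(1) g(1)] ideal.subspace_scale[OF I(1) h(1)])
    have v_notin: "v \<notin> Poly_Mapping.keys g'"
      using h(4)[of v] vg by (simp add: in_keys_iff lk c_def lookup_xpow)
    have key: "u \<in> Poly_Mapping.keys g \<or> (config_degree A u = b \<and> weight \<omega> u < weight \<omega> v)" if u: "u \<in> Poly_Mapping.keys g'" for u
    proof (cases "u \<in> Poly_Mapping.keys g")
      case False
      then have uh: "u \<in> Poly_Mapping.keys h" using u by (auto simp: in_keys_iff lk)
      then have ub: "config_degree A u = b" using h(2) by (simp add: homog_def)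
      have "u \<noteq> v" using False vg(1) by blast
      then have "weight \<omega> u \<noteq> weight \<omega> v" using h(4)[OF ub] uh by (auto simp: in_keys_iff lookup_xpow)
      then show ?thesis using uh h(3) ub by force
    qed auto
    \<comment> \<open>Cancelling the leading exponent \<open>v\<close> introduces only exponents of lower weight.\<close>
    have "D g' \<subseteq> D g"
    proof
      fix u assume "u \<in> D g'"
      then consider "u \<in> Poly_Mapping.keys g'" | x where "config_degree A u = b" "x \<in> Poly_Mapping.keys g'" "weight \<omega> u < weight \<omega> x"
        by (auto simp: D_def)
      then show "u \<in> D g"
      proof cases
        case 1 then show ?thesis using key[of u] vg by (auto simp: D_def)
      next
        case 2
        have "weight \<omega> x \<le> weight \<omega> v" using key[OF 2(2)] vtop by force
        then show ?thesis using 2 vg by (auto simp: D_def intro!: bexI[of _ v])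
      qed
    qed
    moreover have "v \<in> D g" using vg by (simp add: D_def)
    moreover have "v \<notin> D g'"
      using v_notin key vtop by (fastforce simp: D_def)
    ultimately have "D g' \<subset> D g" by blast
    then have "card (D g') < card (D g)"
      using D_sub[OF g(2)] fin by (meson finite_subset psubset_card_mono)
    then show False using min[OF fg' hg'] by simp
  qed
  then show ?thesis using g by blast
qed

section \<open>Generic integer points on the moment curve\<close>

text \<open>The points \<open>(t^(e i))\<^sub>i\<close> lie on a moment curve, which meets each affine hyperplane in finitely
  many points; the exponents are positive because a constant coordinate would confine the curve to a
  hyperplane. This is the source of all generic choices below.\<close>

lemma moment_curve_finite:
  fixes c :: "'i::finite \<Rightarrow> real"
  assumes "inj e" "\<And>i. e i > 0" "c j \<noteq> 0"
  shows "finite {t::nat. (\<Sum>i\<in>UNIV. c i * real t ^ e i) = K}"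
proof -
  define p where "p = (\<Sum>i\<in>UNIV. monom (c i) (e i)) - [:K:]"
  have "coeff p (e j) = (\<Sum>i\<in>UNIV. if i = j then c i else 0) - coeff [:K:] (e j)"
    using assms(1) by (simp add: p_def coeff_sum inj_eq)
  also have "\<dots> = c j" using assms(2)[of j] by (simp add: coeff_pCons split: nat.split)
  finally have "p \<noteq> 0" using assms(3) by auto
  then have "finite (real -` {x. poly p x = 0})"
    by (intro finite_vimageI poly_roots_finite) (auto simp: inj_on_def)
  moreover have "real -` {x. poly p x = 0} = {t. (\<Sum>i\<in>UNIV. c i * real t ^ e i) = K}"
    by (auto simp: p_def poly_sum poly_monom)
  ultimately show ?thesis by simp
qed

lemma ex_exponents: "\<exists>e :: 'i::finite \<Rightarrow> nat. inj e \<and> (\<forall>i. e i > 0)"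
proof -
  obtain f :: "'i \<Rightarrow> nat" where "inj f"
    using finite_imp_inj_to_nat_seg[of "UNIV :: 'i set"] by auto
  then show ?thesis by (intro exI[of _ "\<lambda>i. Suc (f i)"]) (auto simp: inj_def)
qed

text \<open>For distinct \<open>a\<close> and \<open>b\<close> only finitely many points of the moment curve give functionals that
  identify them.\<close>

lemma separating_functional:
  fixes S :: "(int ^ 'd::finite) set"
  assumes "finite S"
  shows "\<exists>l :: int ^ 'd \<Rightarrow> int. (\<forall>a b. l (a + b) = l a + l b) \<and> inj_on l S"
proof -
  obtain e :: "'d \<Rightarrow> nat" where e: "inj e" "\<And>i. e i > 0" using ex_exponents by blast
  define l where "l t b = (\<Sum>i\<in>UNIV. b $ i * int t ^ e i)" for t and b :: "int ^ 'd"
  have "finite {t. l t a = l t b}" if ab: "a \<noteq> b" for a b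
  proof -
    obtain j where j: "a $ j \<noteq> b $ j" using ab by (auto simp: vec_eq_iff)
    have "l t a = l t b \<longleftrightarrow> (\<Sum>i\<in>UNIV. real_of_int (a $ i - b $ i) * real t ^ e i) = 0" for t
    proof -
      have "(\<Sum>i\<in>UNIV. real_of_int (a $ i - b $ i) * real t ^ e i) = real_of_int (l t a - l t b)"
        by (simp add: l_def sum_subtractf algebra_simps)
      then show ?thesis by simp
    qed
    moreover have "finite {t. (\<Sum>i\<in>UNIV. real_of_int (a $ i - b $ i) * real t ^ e i) = 0}"
      by (rule moment_curve_finite[where j = j]) (use e j in auto)
    ultimately show ?thesis by simp
  qed
  then have "finite (\<Union>(a, b)\<in>{(a, b) \<in> S \<times> S. a \<noteq> b}. {t. l t a = l t b})"
    using assms by (intro finite_UN_I finite_subset[OF _ finite_cartesian_product[of S S]]) auto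
  then obtain t where "t \<notin> (\<Union>(a, b)\<in>{(a, b) \<in> S \<times> S. a \<noteq> b}. {t. l t a = l t b})"
    using ex_new_if_finite infinite_UNIV_nat by blast
  then have "inj_on (l t) S" by (auto simp: inj_on_def)
  moreover have "l t (a + b) = l t a + l t b" for a b
    by (simp add: l_def sum.distrib algebra_simps)
  ultimately show ?thesis by blast
qed

section \<open>The toric ideal is prime\<close>

text \<open>Ring homomorphisms out of the polynomial ring, given by their values \<open>T u c\<close> on the terms
  \<open>c x^u\<close>. Two kinds are used: regrading by an integer-valued degree, and evaluation at the
  point whose coordinates are 1 on a set of indices and 0 off it.\<close>

locale term_hom =
  fixes T :: "'a::cancel_comm_monoid_add \<Rightarrow> 'k::comm_ring_1 \<Rightarrow> 'r::comm_ring_1"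
  assumes T_zero: "T u 0 = 0"
    and T_add: "T u (c + d) = T u c + T u d"
    and T_mult: "T (u + v) (c * d) = T u c * T v d"
begin

definition push :: "('a \<Rightarrow>\<^sub>0 'k) \<Rightarrow> 'r" where
  "push f = (\<Sum>u\<in>Poly_Mapping.keys f. T u (Poly_Mapping.lookup f u))"

lemma push_superset:
  assumes "finite B" "Poly_Mapping.keys f \<subseteq> B"
  shows "push f = (\<Sum>u\<in>B. T u (Poly_Mapping.lookup f u))"
  unfolding push_def using assms
  by (intro sum.mono_neutral_left) (auto simp: in_keys_iff T_zero)

lemma push_add: "push (f + g) = push f + push g"
proof -
  let ?B = "Poly_Mapping.keys f \<union> Poly_Mapping.keys g"
  have "push (f + g) = (\<Sum>u\<in>?B. T u (Poly_Mapping.lookup (f + g) u))"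
    using keys_add[of f g] by (intro push_superset) auto
  also have "\<dots> = push f + push g"
    by (simp add: push_superset[of ?B] lookup_add T_add sum.distrib)
  finally show ?thesis .
qed

lemma push_zero: "push 0 = 0" by (simp add: push_def)

lemma push_sum: "push (\<Sum>x\<in>X. f x) = (\<Sum>x\<in>X. push (f x))"
  by (induction X rule: infinite_finite_induct) (simp_all add: push_zero push_add)

lemma push_single: "push (Poly_Mapping.single u c) = T u c"
  by (simp add: push_def T_zero)

lemma push_mult: "push (f * g) = push f * push g"
proof -
  have "f * g = (\<Sum>u\<in>Poly_Mapping.keys f. \<Sum>v\<in>Poly_Mapping.keys g.
      Poly_Mapping.single (u + v) (Poly_Mapping.lookup f u * Poly_Mapping.lookup g v))"
    by (subst poly_mapping_sum_singles[of f], subst poly_mapping_sum_singles[of g])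
       (simp only: sum_product mult_single)
  then have "push (f * g) = (\<Sum>u\<in>Poly_Mapping.keys f. \<Sum>v\<in>Poly_Mapping.keys g.
      T u (Poly_Mapping.lookup f u) * T v (Poly_Mapping.lookup g v))"
    by (simp only: push_sum push_single T_mult)
  then show ?thesis by (simp add: push_def sum_product)
qed

lemma push_diff: "push (f - g) = push f - push g"
  using push_add[of "f - g" g] by simp

lemma push_ideal_span:
  assumes "f \<in> ideal.span G" "\<And>g. g \<in> G \<Longrightarrow> push g = 0" shows "push f = 0"
  using assms(1)
  by (induction rule: ideal.span_induct_alt) (simp_all add: push_zero push_add push_mult assms(2))

end

lemma supp_add: "supp (u + v) = supp u \<union> supp (v :: nat ^ 'n)"
  by (auto simp: supp_def)

lemma term_hom_supp: "term_hom (\<lambda>(u :: nat ^ 'n::finite) (c :: 'k::comm_ring_1). c when supp u \<subseteq> \<tau>)"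
  by standard (auto simp: supp_add when_def)

lemma term_hom_single:
  fixes l :: "'a::cancel_comm_monoid_add \<Rightarrow> int"
  assumes "\<And>u v. l (u + v) = l u + l v"
  shows "term_hom (\<lambda>u (c :: 'k::comm_ring_1). Poly_Mapping.single (l u) c)"
  by standard (simp_all add: single_add mult_single assms)

text \<open>The difference is the greatest common divisor of the two monomials times a lattice binomial.\<close>

lemma xpow_diff_in_toric_ideal:
  assumes "config_degree A u = config_degree A v" shows "xpow u - xpow v \<in> toric_ideal A"
proof -
  define d where "d = (\<chi> i. int (u $ i) - int (v $ i))"
  define m where "m = (\<chi> i. min (u $ i) (v $ i))"
  have d: "d \<in> config_lattice A" using assms by (simp add: d_def config_degree_eq_iff)
  have u: "u = m + pos_part d" and v: "v = m + neg_part d"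
    by (auto simp: m_def d_def vec_eq_iff pos_part_def neg_part_def)
  have "xpow u - xpow v = xpow m * binomial_of d"
    unfolding binomial_of_def right_diff_distrib by (simp only: u v xpow_add)
  also have "\<dots> \<in> toric_ideal A"
    unfolding toric_ideal_def using d by (intro ideal.span_scale ideal.span_base) blast
  finally show ?thesis .
qed

text \<open>Replacing every monomial by a fixed representative of its degree changes \<open>f\<close> by an element of
  the toric ideal; if the coefficients of each degree cancel, nothing is left afterwards.\<close>

lemma toric_idealI:
  fixes f :: "('n::finite, 'k::comm_ring_1) mpoly"
  assumes "\<And>b. (\<Sum>u\<in>{u \<in> Poly_Mapping.keys f. config_degree A u = b}. Poly_Mapping.lookup f u) = 0"
  shows "f \<in> toric_ideal A"
proof -
  define r where "r b = (SOME u. config_degree A u = b)" for b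
  have r: "config_degree A (r (config_degree A u)) = config_degree A u" for u
    unfolding r_def by (rule someI) simp
  let ?K = "Poly_Mapping.keys f" and ?c = "Poly_Mapping.lookup f"
  have "Poly_Mapping.single u c - Poly_Mapping.single (r (config_degree A u)) c \<in> toric_ideal A" for u and c :: 'k
  proof -
    have "Poly_Mapping.single u c - Poly_Mapping.single (r (config_degree A u)) c =
        Poly_Mapping.single 0 c * (xpow u - xpow (r (config_degree A u)))"
      by (simp add: xpow_def mult_single algebra_simps)
    moreover have "xpow u - xpow (r (config_degree A u)) \<in> (toric_ideal A :: ('n, 'k) mpoly set)"
      by (rule xpow_diff_in_toric_ideal) (simp add: r)
    ultimately show ?thesis unfolding toric_ideal_def by (simp only: ideal.span_scale)
  qed
  then have "(\<Sum>u\<in>?K. Poly_Mapping.single u (?c u) - Poly_Mapping.single (r (config_degree A u)) (?c u)) \<in> toric_ideal A"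
    unfolding toric_ideal_def by (intro ideal.span_sum)
  moreover have "(\<Sum>u\<in>?K. Poly_Mapping.single (r (config_degree A u)) (?c u)) = 0"
  proof (rule poly_mapping_eqI)
    fix v
    have "(\<Sum>u\<in>?K. ?c u when r (config_degree A u) = v) = (\<Sum>b\<in>config_degree A ` ?K. \<Sum>u\<in>{u \<in> ?K. config_degree A u = b}. ?c u when r (config_degree A u) = v)"
      by (rule sum.image_gen) simp
    also have "\<dots> = (\<Sum>b\<in>config_degree A ` ?K. (\<Sum>u\<in>{u \<in> ?K. config_degree A u = b}. ?c u) when r b = v)"
      by (intro sum.cong) (auto simp: when_def)
    also have "\<dots> = 0" by (simp add: assms)
    finally show "Poly_Mapping.lookup (\<Sum>u\<in>?K. Poly_Mapping.single (r (config_degree A u)) (?c u)) v = Poly_Mapping.lookup 0 v"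
      by (simp add: lookup_sum lookup_single)
  qed
  ultimately show ?thesis by (simp add: sum_subtractf flip: poly_mapping_sum_singles)
qed

lemma xpow_notin_toric_ideal:
  "xpow u \<notin> (toric_ideal A :: ('n::finite, 'k::comm_ring_1) mpoly set)"
proof
  define \<tau> :: "'n set" where "\<tau> = UNIV"
  have \<tau>: "supp u \<subseteq> \<tau>" for u :: "nat ^ 'n" by (simp add: \<tau>_def)
  interpret h: term_hom "\<lambda>(u :: nat ^ 'n) (c :: 'k). c when supp u \<subseteq> \<tau>" by (rule term_hom_supp)
  assume "xpow u \<in> (toric_ideal A :: ('n, 'k) mpoly set)"
  then have "h.push (xpow u) = 0" unfolding toric_ideal_def
    by (rule h.push_ideal_span) (auto simp: binomial_of_def h.push_diff xpow_def h.push_single,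
        simp add: \<tau>)
  then have "(1 when supp u \<subseteq> \<tau>) = (0 :: 'k)" by (simp add: xpow_def h.push_single)
  then show False by (simp add: \<tau>)
qed

text \<open>The toric ideal is the kernel of the map to the group ring of the degrees. To avoid ordering that
  group, the degrees occurring in \<open>f\<close> and \<open>g\<close> are separated by one additive functional \<open>l\<close>
  with integer values, so that the map to the domain of Laurent polynomials in one variable
  already detects which of the two factors is in the kernel.\<close>

lemma prime_toric_ideal: "prime_ideal (toric_ideal A :: ('n::finite, 'k::idom) mpoly set)"
  unfolding prime_ideal_def
proof (intro conjI allI impI)
  show "ideal.subspace (toric_ideal A :: ('n, 'k) mpoly set)" by (simp add: toric_ideal_def)
  show "(toric_ideal A :: ('n, 'k) mpoly set) \<noteq> UNIV" using xpow_notin_toric_ideal by blast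
  fix f g :: "('n, 'k) mpoly"
  assume fg: "f * g \<in> toric_ideal A"
  let ?S = "config_degree A ` Poly_Mapping.keys f \<union> config_degree A ` Poly_Mapping.keys g"
  obtain l :: "_ \<Rightarrow> int" where l: "\<And>a b. l (a + b) = l a + l b" "inj_on l ?S"
    using separating_functional[of ?S] by auto
  interpret h: term_hom "\<lambda>u (c :: 'k). Poly_Mapping.single (l (config_degree A u)) c"
    by (rule term_hom_single) (simp add: config_degree_add l)
  have "h.push (f * g) = 0" using fg unfolding toric_ideal_def
    by (rule h.push_ideal_span) (auto simp: binomial_of_def h.push_diff xpow_def h.push_single config_degree_parts)
  then have "h.push f = 0 \<or> h.push g = 0" by (simp add: h.push_mult)
  moreover have "p \<in> toric_ideal A" if p: "h.push p = 0" "config_degree A ` Poly_Mapping.keys p \<subseteq> ?S" for p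
  proof (rule toric_idealI)
    fix b
    show "(\<Sum>u\<in>{u \<in> Poly_Mapping.keys p. config_degree A u = b}. Poly_Mapping.lookup p u) = 0"
    proof (cases "b \<in> config_degree A ` Poly_Mapping.keys p")
      case True
      have "0 = Poly_Mapping.lookup (h.push p) (l b)" using p by simp
      also have "\<dots> = (\<Sum>u\<in>Poly_Mapping.keys p. Poly_Mapping.lookup p u when l (config_degree A u) = l b)"
        by (simp add: h.push_def lookup_sum lookup_single)
      also have "\<dots> = (\<Sum>u\<in>Poly_Mapping.keys p. if config_degree A u = b then Poly_Mapping.lookup p u else 0)"
        using l(2) p(2) True by (intro sum.cong) (auto simp: when_def dest!: inj_onD)
      finally show ?thesis by (simp add: sum.inter_filter)
    qed (auto intro!: sum.neutral)
  qed
  ultimately show "f \<in> toric_ideal A \<or> g \<in> toric_ideal A" by blast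
qed

section \<open>Faces\<close>

lemma convex_cone_face:
  assumes "F face_of C" "convex_cone C" "F \<noteq> {}"
  shows "convex_cone F"
proof -
  have F: "F \<subseteq> C" "convex F" and ext: "\<And>a b x. a \<in> C \<Longrightarrow> b \<in> C \<Longrightarrow> x \<in> F \<Longrightarrow> x \<in> open_segment a b \<Longrightarrow> a \<in> F \<and> b \<in> F"
    using assms(1) unfolding face_of_def by blast+
  have C0: "0 \<in> C" using assms(2) by (rule convex_cone_contains_0)
  have scale: "c *\<^sub>R x \<in> F \<and> 0 \<in> F" if "x \<in> F" "c > 1" for c x
  proof (cases "x = 0")
    case False
    \<comment> \<open>The point \<open>x\<close> is interior to the segment from the apex to \<open>c x\<close>, which therefore lies in the face.\<close>
    have "x = (1 - 1 / c) *\<^sub>R 0 + (1 / c) *\<^sub>R (c *\<^sub>R x)" using that by simp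
    then have "x \<in> open_segment 0 (c *\<^sub>R x)"
      using that False unfolding in_segment by (intro conjI exI[of _ "1 / c"]) auto
    moreover have "c *\<^sub>R x \<in> C" using that F(1) assms(2) by (intro convex_cone_scaleR) auto
    ultimately show ?thesis using ext[OF C0 _ that(1)] by blast
  qed (use that in simp)
  obtain y where "y \<in> F" using assms(3) by blast
  then have F0: "0 \<in> F" using scale[of y 2] by simp
  have "c *\<^sub>R x \<in> F" if "x \<in> F" "c \<ge> 0" for c x
  proof (cases "c > 1")
    case False
    then have "(1 - c) *\<^sub>R 0 + c *\<^sub>R x \<in> F" using that by (intro convexD[OF F(2) F0]) auto
    then show ?thesis by simp
  qed (use scale that in blast)
  then show ?thesis using F(2) assms(3) by (auto simp: convex_cone_def conic_def)
qed

text \<open>The sum \<open>x + y\<close> is the midpoint of \<open>2 x\<close> and \<open>2 y\<close>.\<close>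

lemma face_sum_memD:
  assumes F: "F face_of C" and C: "convex_cone C" and xy: "x \<in> C" "y \<in> C" "x + y \<in> F"
  shows "x \<in> F"
proof -
  have cF: "convex_cone F" using convex_cone_face[OF F C] xy(3) by blast
  have half: "x \<in> F" if "2 *\<^sub>R x \<in> F"
    using convex_cone_scaleR[OF cF, of "1/2" "2 *\<^sub>R x"] that by simp
  show ?thesis
  proof (cases "x = y")
    case True
    then show ?thesis using half xy(3) by (simp add: scaleR_2)
  next
    case False
    have "x + y = (1 - 1/2) *\<^sub>R (2 *\<^sub>R x) + (1/2) *\<^sub>R (2 *\<^sub>R y)" by simp
    then have "x + y \<in> open_segment (2 *\<^sub>R x) (2 *\<^sub>R y)"
      using False unfolding in_segment by (intro conjI exI[of _ "1/2"]) auto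
    moreover have "2 *\<^sub>R x \<in> C" "2 *\<^sub>R y \<in> C" using C xy by (auto intro: convex_cone_scaleR)
    ultimately have "2 *\<^sub>R x \<in> F" using F xy(3) unfolding face_of_def by blast
    then show ?thesis by (rule half)
  qed
qed

lemma convex_cone_sum: "convex_cone C \<Longrightarrow> (\<And>i. i \<in> B \<Longrightarrow> f i \<in> C) \<Longrightarrow> sum f B \<in> C"
  by (induction B rule: infinite_finite_induct) (auto simp: convex_cone_contains_0 convex_cone_add)

lemma real_config_degree:
  "(\<chi> i. real_of_int (config_degree A u $ i)) = (\<Sum>j\<in>UNIV. real (u $ j) *\<^sub>R column j (real_matrix A))"
  by (simp add: vec_eq_iff config_degree_def matrix_vector_mult_def column_def real_matrix_def
      map_matrix_def mult.commute)

text \<open>A sum of elements of a cone is in a face only if all summands are. So whether a monomial involves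
  only variables of the face depends only on its degree, and the two monomials of a lattice binomial
  have equal values at the point with coordinates 1 on the face and 0 off it.\<close>

lemma face_supp_iff:
  assumes F: "F face_of cone_over A UNIV" "F \<noteq> {}"
  shows "supp u \<subseteq> {j. column j (real_matrix A) \<in> F} \<longleftrightarrow> (\<chi> i. real_of_int (config_degree A u $ i)) \<in> F"
proof -
  let ?a = "\<lambda>j. column j (real_matrix A)"
  have C: "convex_cone (cone_over A UNIV)" unfolding cone_over_def by (rule convex_cone_convex_cone_hull)
  have aC: "?a j \<in> cone_over A UNIV" for j unfolding cone_over_def by (intro hull_inc) simp
  have cF: "convex_cone F" by (rule convex_cone_face[OF F(1) C F(2)])
  have "(\<Sum>j\<in>UNIV. real (u $ j) *\<^sub>R ?a j) \<in> F" if "supp u \<subseteq> {j. ?a j \<in> F}"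
  proof (rule convex_cone_sum[OF cF])
    fix j show "real (u $ j) *\<^sub>R ?a j \<in> F"
    proof (cases "u $ j = 0")
      case True then show ?thesis using convex_cone_contains_0[OF cF] by simp
    next
      case False
      then have "?a j \<in> F" using that by (auto simp: supp_def)
      then show ?thesis using cF by (intro convex_cone_scaleR) auto
    qed
  qed
  moreover have "?a j \<in> F" if "(\<Sum>j\<in>UNIV. real (u $ j) *\<^sub>R ?a j) \<in> F" "u $ j \<noteq> 0" for j
  proof -
    let ?x = "\<lambda>j. real (u $ j) *\<^sub>R ?a j"
    have x: "?x i \<in> cone_over A UNIV" for i
      using C aC by (intro convex_cone_scaleR) auto
    have "(\<Sum>j\<in>UNIV. ?x j) = ?x j + (\<Sum>j\<in>UNIV - {j}. ?x j)"
      by (rule sum.remove) auto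
    then have "?x j + (\<Sum>j\<in>UNIV - {j}. ?x j) \<in> F" using that(1) by simp
    then have "?x j \<in> F"
      by (rule face_sum_memD[OF F(1) C x convex_cone_sum[OF C x]])
    from convex_cone_scaleR[OF cF _ this, of "1 / real (u $ j)"] show ?thesis using that(2) by simp
  qed
  ultimately show ?thesis unfolding real_config_degree by (auto simp: supp_def)
qed

text \<open>The prime vanishes at the point with coordinates 1 on the face and 0 off it, where the
  monomial takes the value 1.\<close>

lemma xpow_notin_face_prime:
  assumes "is_face A \<tau>" "supp u \<subseteq> \<tau>"
  shows "xpow u \<notin> ideal_sum (coord_prime \<tau>) (toric_ideal A :: ('n::finite, 'k::comm_ring_1) mpoly set)"
proof
  interpret h: term_hom "\<lambda>(u :: nat ^ 'n) (c :: 'k). c when supp u \<subseteq> \<tau>" by (rule term_hom_supp)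
  obtain F where F: "F face_of cone_over A UNIV" "F \<noteq> {}" "\<tau> = {j. column j (real_matrix A) \<in> F}"
    using assms(1) by (auto simp: is_face_def)
  have "h.push (binomial_of c) = 0" if c: "c \<in> config_lattice A" for c
  proof -
    have "supp (pos_part c) \<subseteq> \<tau> \<longleftrightarrow> supp (neg_part c) \<subseteq> \<tau>"
      unfolding F(3) face_supp_iff[OF F(1,2)] config_degree_parts[OF c] ..
    then show ?thesis by (simp add: binomial_of_def h.push_diff xpow_def h.push_single)
  qed
  then have toric: "h.push f = 0" if "f \<in> toric_ideal A" for f
    using that unfolding toric_ideal_def by (auto intro: h.push_ideal_span)
  have coord: "h.push f = 0" if "f \<in> coord_prime \<tau>" for f
    using that unfolding coord_prime_def
    by (rule h.push_ideal_span) (auto simp: var_def xpow_def h.push_single,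
        auto simp: supp_def axis_def when_def)
  assume "xpow u \<in> ideal_sum (coord_prime \<tau>) (toric_ideal A :: ('n, 'k) mpoly set)"
  then obtain f g where "xpow u = f + g" "f \<in> coord_prime \<tau>" "g \<in> (toric_ideal A :: ('n, 'k) mpoly set)"
    by (auto simp: ideal_sum_def)
  then have "h.push (xpow u) = 0" by (simp add: h.push_add toric coord)
  then show False using assms(2) by (simp add: xpow_def h.push_single)
qed

section \<open>Standard pairs\<close>

text \<open>The order on pairs whose maximal admissible elements are the standard pairs: \<open>q\<close> covers
  every monomial covered by \<open>p\<close>.\<close>

definition extends :: "(nat ^ 'n) \<times> 'n set \<Rightarrow> (nat ^ 'n) \<times> 'n set \<Rightarrow> bool" where
  "extends q p \<longleftrightarrow> fst q \<le> fst p \<and> supp (fst p - fst q) \<union> snd p \<subseteq> snd q"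

lemma extends_trans:
  assumes "extends r q" "extends q p" shows "extends r p"
proof -
  have "supp (fst p - fst r) \<subseteq> supp (fst p - fst q) \<union> supp (fst q - fst r)"
    by (auto simp: supp_def)
  then show ?thesis using assms by (auto simp: extends_def)
qed

lemma lies_on_extends:
  assumes "extends q p" "lies_on v p" shows "lies_on v q"
proof -
  obtain w where w: "supp w \<subseteq> snd p" "v = fst p + w" using assms(2) by (auto simp: lies_on_def)
  have "fst p = fst q + (fst p - fst q)"
    using assms(1) by (auto simp: extends_def vec_eq_iff less_eq_vec_def)
  then have "v = fst q + ((fst p - fst q) + w)" using w(2) by (metis add.assoc)
  moreover have "supp ((fst p - fst q) + w) \<subseteq> snd q"
    using assms(1) w(1) by (auto simp: extends_def supp_add)
  ultimately show ?thesis unfolding lies_on_def by blast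
qed

lemma admissible_extends_standard:
  fixes M :: "('n::finite, 'k::comm_ring_1) mpoly set"
  assumes "admissible_pair M p"
  shows "\<exists>q. standard_pair M q \<and> extends q p"
proof -
  \<comment> \<open>Extending a pair removes mass from the root or adds directions, so this measure decreases.\<close>
  define \<mu> where "\<mu> q = (\<Sum>i\<in>UNIV. fst q $ i) + card (- snd q)" for q :: "(nat ^ 'n) \<times> 'n set"
  have less: "\<mu> r < \<mu> q" if "extends r q" "r \<noteq> q" for r q
  proof -
    have le: "\<And>i. fst r $ i \<le> fst q $ i" and sub: "- snd r \<subseteq> - snd q"
      using that(1) by (auto simp: extends_def less_eq_vec_def)
    have c: "card (- snd r) \<le> card (- snd q)" using sub by (intro card_mono) auto
    have s: "(\<Sum>i\<in>UNIV. fst r $ i) \<le> (\<Sum>i\<in>UNIV. fst q $ i)" using le by (intro sum_mono)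
    show ?thesis
    proof (cases "fst r = fst q")
      case True
      then have "- snd r \<subset> - snd q" using that(2) sub by (auto simp: prod_eq_iff)
      then have "card (- snd r) < card (- snd q)" by (intro psubset_card_mono) auto
      then show ?thesis using s by (simp add: \<mu>_def)
    next
      case False
      then obtain i where "fst r $ i \<noteq> fst q $ i" by (auto simp: vec_eq_iff)
      then have "fst r $ i < fst q $ i" using le[of i] by simp
      then have "(\<Sum>i\<in>UNIV. fst r $ i) < (\<Sum>i\<in>UNIV. fst q $ i)"
        using le by (intro sum_strict_mono_ex1) auto
      then show ?thesis using c by (simp add: \<mu>_def)
    qed
  qed
  have "extends p p" by (auto simp: extends_def supp_def)
  then obtain q where q: "admissible_pair M q" "extends q p"
    and min: "\<And>r. admissible_pair M r \<Longrightarrow> extends r p \<Longrightarrow> \<mu> q \<le> \<mu> r"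
    using ex_has_least_nat[of "\<lambda>q. admissible_pair M q \<and> extends q p" p \<mu>] assms by auto
  have "r = q" if "admissible_pair M r" "extends r q" for r
    using min[OF that(1) extends_trans[OF that(2) q(2)]] less[OF that(2)] by linarith
  then have "standard_pair M q" using q(1) unfolding standard_pair_def extends_def by blast
  then show ?thesis using q(2) by blast
qed

section \<open>Circuits\<close>

lemma config_lattice_scale:
  "(\<chi> i. g * c $ i) \<in> config_lattice A \<longleftrightarrow> g = 0 \<or> c \<in> config_lattice A"
proof -
  have "(\<Sum>j\<in>UNIV. A $ i $ j * (g * c $ j)) = g * (\<Sum>j\<in>UNIV. A $ i $ j * c $ j)" for i
    unfolding sum_distrib_left by (intro sum.cong refl mult.left_commute)
  then show ?thesis by (simp add: config_lattice_def vec_eq_iff matrix_vector_mult_def)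
qed

text \<open>A nonzero lattice vector of minimal support below \<open>d\<close>, divided by the gcd of its entries.\<close>

lemma circuit_below:
  fixes A :: "int ^ 'n ^ 'd"
  assumes "d \<in> config_lattice A" "d \<noteq> 0"
  shows "\<exists>c. circuit A c \<and> supp c \<subseteq> supp d"
proof -
  obtain m where m: "m \<in> config_lattice A" "m \<noteq> 0" "supp m \<subseteq> supp d"
    and min: "\<And>x. x \<in> config_lattice A \<Longrightarrow> x \<noteq> 0 \<Longrightarrow> supp x \<subseteq> supp d \<Longrightarrow> card (supp m) \<le> card (supp x)"
    using ex_has_least_nat[of "\<lambda>x. x \<in> config_lattice A \<and> x \<noteq> 0 \<and> supp x \<subseteq> supp d" d "\<lambda>x. card (supp x)"] assms
    by auto
  define g where "g = Gcd (range (($) m))"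
  define c where "c = (\<chi> i. m $ i div g)"
  have mi: "m $ i = g * c $ i" for i
    by (simp add: c_def g_def)
  obtain i where "m $ i \<noteq> 0" using m(2) by (auto simp: vec_eq_iff)
  then have g0: "g \<noteq> 0" using mi[of i] by auto
  have supp: "supp c = supp m" using g0 by (auto simp: supp_def mi)
  have "m = (\<chi> i. g * c $ i)" by (simp add: vec_eq_iff mi)
  then have cL: "c \<in> config_lattice A" using m(1) g0 config_lattice_scale[of g c A] by simp
  have c0: "c \<noteq> 0" using \<open>m $ i \<noteq> 0\<close> mi[of i] by auto
  have "range (($) m) = (*) g ` range (($) c)" by (auto simp: image_image mi)
  then have "g = normalize (g * Gcd (range (($) c)))" by (metis g_def Gcd_mult)
  moreover have "g \<ge> 0" by (simp add: g_def)
  ultimately have "Gcd (range (($) c)) = 1" using g0 by (simp add: abs_mult)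
  moreover have "\<not> supp x \<subset> supp c" if x: "x \<in> config_lattice A" "x \<noteq> 0" for x
  proof
    assume "supp x \<subset> supp c"
    then have "card (supp x) < card (supp m)" by (simp add: supp psubset_card_mono)
    moreover have "card (supp m) \<le> card (supp x)"
      using \<open>supp x \<subset> supp c\<close> m(3) by (intro min x) (auto simp: supp)
    ultimately show False by simp
  qed
  ultimately show ?thesis using cL c0 m(3) unfolding circuit_def supp[symmetric] by blast
qed

lemma xpow_eq_iff: "xpow u = (xpow v :: ('n::finite, 'k::comm_ring_1) mpoly) \<longleftrightarrow> u = v"
proof
  assume "xpow u = (xpow v :: ('n, 'k) mpoly)"
  then have "Poly_Mapping.lookup (xpow u :: ('n, 'k) mpoly) u = Poly_Mapping.lookup (xpow v) u" by simp
  then show "u = v" by (simp add: lookup_xpow when_def split: if_splits)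
qed simp

lemma monomial_ideal_init_ideal_up:
  "xpow u \<in> init_ideal \<omega> I \<Longrightarrow> xpow (w + u) \<in> init_ideal \<omega> I"
  unfolding init_ideal_def xpow_add by (rule ideal.span_scale)

text \<open>Otherwise the type contains the support of a circuit. One of the two monomials of its binomial
  lies in the initial ideal, yet it only involves directions of the pair.\<close>

lemma admissible_type_lattice_free:
  fixes A :: "int ^ 'n ^ 'd"
  assumes mon: "monomial_ideal (init_ideal \<omega> (circuit_ideal A) :: ('n, 'k::comm_ring_1) mpoly set)"
    and adm: "admissible_pair (init_ideal \<omega> (circuit_ideal A) :: ('n, 'k) mpoly set) (u, \<beta>)"
    and d: "d \<in> config_lattice A" "supp d \<subseteq> \<beta>"
  shows "d = 0"
proof (rule ccontr)
  assume "d \<noteq> 0"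
  then obtain c where c: "circuit A c" "supp c \<subseteq> \<beta>" using circuit_below[OF d(1)] d(2) by blast
  let ?h = "binomial_of c :: ('n, 'k) mpoly"
  let ?M = "init_ideal \<omega> (circuit_ideal A) :: ('n, 'k) mpoly set"
  have "pos_part c \<noteq> neg_part c"
  proof
    assume eq: "pos_part c = neg_part c"
    have "c $ i = 0" for i
      using arg_cong[OF eq, of "\<lambda>u. u $ i"] by (simp add: pos_part_def neg_part_def)
    then show False using c(1) by (auto simp: circuit_def vec_eq_iff)
  qed
  then have "?h \<noteq> 0" by (simp add: binomial_of_def xpow_eq_iff)
  then obtain v where v: "v \<in> Poly_Mapping.keys (init_form \<omega> ?h)"
    using keys_init_form_nonempty[of ?h \<omega>] by blast
  have "Poly_Mapping.keys ?h \<subseteq> {pos_part c, neg_part c}"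
    using keys_diff[of "xpow (pos_part c) :: ('n, 'k) mpoly" "xpow (neg_part c)"]
    by (auto simp: binomial_of_def xpow_def)
  then have "v = pos_part c \<or> v = neg_part c" using v by (auto simp: keys_init_form)
  then have "supp v \<subseteq> supp c" by (auto simp: supp_def pos_part_def neg_part_def)
  then have "lies_on (u + v) (u, \<beta>)" using c(2) unfolding lies_on_def by auto
  then have "xpow (u + v) \<notin> ?M" using adm unfolding admissible_pair_def by blast
  moreover have "?h \<in> circuit_ideal A"
    unfolding circuit_ideal_def using c(1) by (intro ideal.span_base) blast
  then have "init_form \<omega> ?h \<in> ?M" unfolding init_ideal_def by (intro ideal.span_base imageI)
  then have "xpow v \<in> ?M" using v monomial_ideal_iff_keys[OF mon] by blast
  then have "xpow (u + v) \<in> ?M" by (rule monomial_ideal_init_ideal_up)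
  ultimately show False by blast
qed

section \<open>Integer relations, and the dimension of a face\<close>

text \<open>The reals are a vector space over the rationals, so the coefficient of \<open>r0\<close> with respect to a basis
  that contains \<open>r0\<close> is a rational-valued linear functional with value 1 at \<open>r0\<close>.\<close>

lemma additive_to_rat:
  fixes r0 :: real
  assumes "r0 \<noteq> 0"
  shows "\<exists>\<phi> :: real \<Rightarrow> rat. \<phi> r0 = 1 \<and> (\<forall>x y. \<phi> (x + y) = \<phi> x + \<phi> y) \<and>
    (\<forall>z x. \<phi> (real_of_int z * x) = of_int z * \<phi> x)"
proof -
  interpret R: vector_space_pair "\<lambda>q (x :: real). of_rat q * x" "(*) :: rat \<Rightarrow> rat \<Rightarrow> rat"
    by unfold_locales (simp_all add: distrib_left distrib_right of_rat_add of_rat_mult)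
  have "R.vs1.independent {r0}" using assms by (simp add: R.vs1.dependent_single)
  then obtain \<phi> where \<phi>: "Vector_Spaces.linear (\<lambda>q (x :: real). of_rat q * x) (*) \<phi>" "\<phi> r0 = (1 :: rat)"
    using R.linear_independent_extend[of "{r0}" "\<lambda>_. 1"] by auto
  interpret L: Vector_Spaces.linear "\<lambda>q (x :: real). of_rat q * x" "(*) :: rat \<Rightarrow> rat \<Rightarrow> rat" \<phi> by (rule \<phi>(1))
  have "\<phi> (real_of_int z * x) = of_int z * \<phi> x" for z x
    using L.scale[of "of_int z" x] by (simp only: of_rat_of_int_eq)
  then show ?thesis using L.add \<phi>(2) by blast
qed

lemma common_denominator:
  fixes B :: "rat set"
  assumes "finite B"
  shows "\<exists>N::int. N > 0 \<and> (\<forall>q\<in>B. \<exists>z. of_int N * q = of_int z)"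
  using assms
proof (induction B)
  case empty then show ?case by (intro exI[of _ 1]) simp
next
  case (insert q B)
  then obtain N where N: "N > 0" "\<forall>q\<in>B. \<exists>z. of_int N * q = of_int z" by blast
  obtain a b where ab: "quotient_of q = (a, b)" by (cases "quotient_of q")
  have q: "q = of_int a / of_int b" "b > 0"
    using quotient_of_div[OF ab] quotient_of_denom_pos[OF ab] by simp_all
  have "\<exists>z. of_int (b * N) * x = of_int z" if xB: "x \<in> insert q B" for x
  proof (cases "x = q")
    case True
    have "of_int (b * N) * x = (of_int (N * a) :: rat)" unfolding True q(1) using q(2) by simp
    then show ?thesis by blast
  next
    case False
    then obtain z where "of_int N * x = of_int z" using xB N(2) by auto
    then have "of_int (b * N) * x = of_int (b * z)" by (simp only: of_int_mult mult.assoc)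
    then show ?thesis by blast
  qed
  then show ?case using N(1) q(2) by (intro exI[of _ "b * N"]) auto
qed

text \<open>A rational-valued additive functional turns a real relation among integer vectors into a
  rational one whose support is no larger, and which is nonzero at the index where the functional takes
  the value 1; clearing denominators makes it integral.\<close>

lemma real_relation_imp_lattice:
  fixes A :: "int ^ 'n ^ 'd"
  assumes rel: "(\<Sum>j\<in>UNIV. r j *\<^sub>R column j (real_matrix A)) = 0"
    and nz: "r j0 \<noteq> 0" and out: "\<And>j. j \<notin> \<beta> \<Longrightarrow> r j = 0"
  shows "\<exists>d\<in>config_lattice A. d \<noteq> 0 \<and> supp d \<subseteq> \<beta>"
proof -
  obtain \<phi> :: "real \<Rightarrow> rat" where \<phi>: "\<phi> (r j0) = 1" "\<And>x y. \<phi> (x + y) = \<phi> x + \<phi> y"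
    "\<And>z x. \<phi> (real_of_int z * x) = of_int z * \<phi> x"
    using additive_to_rat[OF nz] by blast
  have \<phi>0: "\<phi> 0 = 0" using \<phi>(2)[of 0 0] by simp
  have \<phi>sum: "\<phi> (sum f B) = (\<Sum>j\<in>B. \<phi> (f j))" for f and B :: "'n set"
    by (induction B rule: infinite_finite_induct) (simp_all add: \<phi>0 \<phi>(2))
  have row: "(\<Sum>j\<in>UNIV. of_int (A $ i $ j) * \<phi> (r j)) = 0" for i
  proof -
    have "(\<Sum>j\<in>UNIV. real_of_int (A $ i $ j) * r j) = 0"
      using arg_cong[OF rel, of "\<lambda>x. x $ i"]
      by (simp add: column_def real_matrix_def map_matrix_def mult.commute)
    from arg_cong[OF this, of \<phi>] show ?thesis by (simp only: \<phi>sum \<phi>(3) \<phi>0)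
  qed
  obtain N :: int where N: "N > 0" "\<forall>q\<in>range (\<lambda>j. \<phi> (r j)). \<exists>z. of_int N * q = of_int z"
    using common_denominator[of "range (\<lambda>j. \<phi> (r j))"] by auto
  then have "\<forall>j. \<exists>z. of_int N * \<phi> (r j) = of_int z" by simp
  from choice[OF this] obtain z where "\<forall>j. of_int N * \<phi> (r j) = of_int (z j)" ..
  then have z: "of_int N * \<phi> (r j) = of_int (z j)" for j by simp
  define d where "d = (\<chi> j. z j)"
  have "A *v d = 0"
  proof -
    have "(\<Sum>j\<in>UNIV. A $ i $ j * z j) = 0" for i
    proof -
      have "(of_int (\<Sum>j\<in>UNIV. A $ i $ j * z j) :: rat) = of_int N * (\<Sum>j\<in>UNIV. of_int (A $ i $ j) * \<phi> (r j))"
        unfolding of_int_sum of_int_mult z[symmetric] sum_distrib_left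
        by (intro sum.cong refl mult.left_commute)
      then have "(of_int (\<Sum>j\<in>UNIV. A $ i $ j * z j) :: rat) = 0" by (simp only: row mult_zero_right)
      then show ?thesis by (simp only: of_int_eq_0_iff)
    qed
    then show ?thesis by (simp add: vec_eq_iff matrix_vector_mult_def d_def)
  qed
  moreover have "z j0 \<noteq> 0"
  proof
    assume "z j0 = 0"
    then show False using z[of j0] \<phi>(1) N(1) by simp
  qed
  then have "d \<noteq> 0" by (auto simp: d_def vec_eq_iff)
  moreover have "z j = 0" if "j \<notin> \<beta>" for j
    using z[of j] out[OF that] \<phi>0 by simp
  then have "supp d \<subseteq> \<beta>" by (auto simp: d_def supp_def)
  ultimately show ?thesis by (auto simp: config_lattice_def)
qed

lemma lattice_free_columns:
  fixes A :: "int ^ 'n ^ 'd"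
  assumes free: "\<And>d. d \<in> config_lattice A \<Longrightarrow> supp d \<subseteq> \<beta> \<Longrightarrow> d = 0"
  shows "inj_on (\<lambda>j. column j (real_matrix A)) \<beta> \<and>
    independent ((\<lambda>j. column j (real_matrix A)) ` \<beta>)"
proof -
  let ?a = "\<lambda>j. column j (real_matrix A)"
  have rel: "r j = 0" if "(\<Sum>j\<in>\<beta>. r j *\<^sub>R ?a j) = 0" "j \<in> \<beta>" for r j
  proof (rule ccontr)
    assume "r j \<noteq> 0"
    define s where "s j = (if j \<in> \<beta> then r j else 0)" for j
    have "(\<Sum>j\<in>UNIV. s j *\<^sub>R ?a j) = (\<Sum>j\<in>\<beta>. r j *\<^sub>R ?a j)"
      by (rule sum.mono_neutral_cong_right) (auto simp: s_def)
    then have "\<exists>d\<in>config_lattice A. d \<noteq> 0 \<and> supp d \<subseteq> \<beta>"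
      using that \<open>r j \<noteq> 0\<close> by (intro real_relation_imp_lattice[where r = s and ?j0.0 = j]) (auto simp: s_def)
    then show False using free by blast
  qed
  have inj: "inj_on ?a \<beta>"
  proof (rule inj_onI, rule ccontr)
    fix i j assume ij: "i \<in> \<beta>" "j \<in> \<beta>" "?a i = ?a j" "i \<noteq> j"
    let ?r = "\<lambda>k. if k = i then 1 else if k = j then - 1 else (0::real)"
    have "(\<Sum>k\<in>\<beta>. ?r k *\<^sub>R ?a k) = (\<Sum>k\<in>{i, j}. ?r k *\<^sub>R ?a k)"
      using ij by (intro sum.mono_neutral_right) auto
    also have "\<dots> = 0" using ij by simp
    finally show False using rel[of ?r i] ij(1) by simp
  qed
  moreover have "independent (?a ` \<beta>)"
  proof
    assume "dependent (?a ` \<beta>)"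
    then obtain u v where u: "v \<in> ?a ` \<beta>" "u v \<noteq> 0" "(\<Sum>v\<in>?a ` \<beta>. u v *\<^sub>R v) = 0"
      using dependent_finite[of "?a ` \<beta>"] by auto
    then have "(\<Sum>j\<in>\<beta>. u (?a j) *\<^sub>R ?a j) = 0" by (simp add: sum.reindex[OF inj])
    then show False using rel[of "\<lambda>j. u (?a j)"] u(1,2) by auto
  qed
  ultimately show ?thesis by blast
qed

lemma aff_dim_cone_over:
  "aff_dim (cone_over A \<tau>) = int (dim ((\<lambda>j. column j (real_matrix A)) ` \<tau>))"
proof -
  let ?S = "(\<lambda>j. column j (real_matrix A)) ` \<tau>"
  have "span (cone_over A \<tau>) = span ?S"
  proof (rule span_eq[THEN iffD2], intro conjI)
    show "cone_over A \<tau> \<subseteq> span ?S"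
      unfolding cone_over_def by (intro hull_minimal convex_cone_span) (simp add: span_superset)
    show "?S \<subseteq> span (cone_over A \<tau>)"
      unfolding cone_over_def by (meson hull_subset order_trans span_superset)
  qed
  then have "dim (cone_over A \<tau>) = dim ?S" by (metis dim_span)
  moreover have "0 \<in> affine hull (cone_over A \<tau>)"
    unfolding cone_over_def by (intro hull_inc convex_cone_hull_contains_0)
  ultimately show ?thesis by (simp add: aff_dim_zero)
qed

text \<open>Integral independence of the columns in \<open>\<beta>\<close> is real independence, so they form a basis of the
  span of the columns in \<open>\<tau>\<close>. A face that contains them contains the intersection of the cone with
  this span, hence all columns in \<open>\<tau>\<close>, so it cannot be smaller.\<close>

lemma type_spans_faceI:
  fixes A :: "int ^ 'n ^ 'd"
  assumes sub: "\<beta> \<subseteq> \<tau>"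
    and free: "\<And>d. d \<in> config_lattice A \<Longrightarrow> supp d \<subseteq> \<beta> \<Longrightarrow> d = 0"
    and span: "\<And>j. j \<in> \<tau> \<Longrightarrow> column j (real_matrix A) \<in> span ((\<lambda>j. column j (real_matrix A)) ` \<beta>)"
  shows "type_spans_face A \<tau> \<beta>"
proof -
  let ?a = "\<lambda>j. column j (real_matrix A)"
  have indep: "inj_on ?a \<beta> \<and> independent (?a ` \<beta>)"
    by (rule lattice_free_columns) (rule free)
  have "span (?a ` \<tau>) = span (?a ` \<beta>)"
    using span sub span_superset[of "?a ` \<tau>"] by (intro span_eq[THEN iffD2]) auto
  then have "dim (?a ` \<tau>) = dim (?a ` \<beta>)" by (metis dim_span)
  also have "\<dots> = card \<beta>" using indep by (simp add: dim_eq_card_independent card_image)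
  finally have dim: "int (card \<beta>) = aff_dim (cone_over A \<tau>)" by (simp add: aff_dim_cone_over)
  have "\<not> \<beta> \<subseteq> \<sigma>" if \<sigma>: "is_face A \<sigma>" "\<sigma> \<subset> \<tau>" for \<sigma>
  proof
    assume "\<beta> \<subseteq> \<sigma>"
    obtain F where F: "F face_of cone_over A UNIV" "F \<noteq> {}" "\<sigma> = {j. ?a j \<in> F}"
      using \<sigma>(1) by (auto simp: is_face_def)
    obtain j where j: "j \<in> \<tau>" "j \<notin> \<sigma>" using \<sigma>(2) by blast
    have C: "convex_cone (cone_over A UNIV)" unfolding cone_over_def by (rule convex_cone_convex_cone_hull)
    have "0 \<in> F" using convex_cone_contains_0[OF convex_cone_face[OF F(1) C F(2)]] .
    then have aff: "affine hull F = span F" by (intro affine_hull_span_0 hull_inc)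
    have "?a ` \<beta> \<subseteq> F" using \<open>\<beta> \<subseteq> \<sigma>\<close> F(3) by auto
    then have "?a j \<in> affine hull F" unfolding aff using span[OF j(1)] span_mono by blast
    moreover have "?a j \<in> cone_over A UNIV" unfolding cone_over_def by (intro hull_inc) simp
    moreover have "F = affine hull F \<inter> cone_over A UNIV"
      using C F(1) by (intro face_of_imp_eq_affine_Int) (auto simp: convex_cone_def)
    ultimately have "?a j \<in> F" by blast
    then show False using j(2) F(3) by simp
  qed
  then show ?thesis using sub dim by (auto simp: type_spans_face_def)
qed

section \<open>A standard pair that spans the face\<close>

lemma supp_subset_iff: "supp u \<subseteq> B \<longleftrightarrow> (\<forall>i. i \<notin> B \<longrightarrow> u $ i = 0)"
  by (auto simp: supp_def)

text \<open>Below a monotone sequence of standard exponents everything is standard. Hence all directions in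
  which the sequence is unbounded are free directions at the eventual value of
  the bounded coordinates.\<close>

lemma unbounded_coordinates_admissible:
  fixes M :: "('n::finite, 'k::comm_ring_1) mpoly set"
  assumes down: "\<And>u w. xpow u \<in> M \<Longrightarrow> xpow (w + u) \<in> M"
    and v: "\<And>k. xpow (v k) \<notin> M" and inc: "\<And>i. incseq (\<lambda>k. v k $ i)"
  shows "\<exists>\<beta> K. (\<forall>k\<ge>K. \<forall>i. i \<notin> \<beta> \<longrightarrow> v k $ i = v K $ i) \<and>
    admissible_pair M (\<chi> i. if i \<in> \<beta> then 0 else v K $ i, \<beta>)"
proof -
  define \<beta> where "\<beta> = {i. \<forall>N. \<exists>k. N \<le> v k $ i}"
  have "\<exists>K. i \<notin> \<beta> \<longrightarrow> (\<forall>k\<ge>K. v k $ i = v K $ i)" for i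
  proof (cases "i \<in> \<beta>")
    case False
    then have "\<exists>N. \<forall>k. v k $ i < N" by (simp add: \<beta>_def not_le)
    then obtain N where "\<forall>k. v k $ i < N" ..
    then have "range (\<lambda>k. v k $ i) \<subseteq> {..<N}" by auto
    then have fin: "finite (range (\<lambda>k. v k $ i))" by (rule finite_subset) simp
    then have "Max (range (\<lambda>k. v k $ i)) \<in> range (\<lambda>k. v k $ i)" by (intro Max_in) auto
    then obtain K where K: "v K $ i = Max (range (\<lambda>k. v k $ i))" by auto
    have "v k $ i = v K $ i" if "k \<ge> K" for k
    proof (rule antisym)
      show "v k $ i \<le> v K $ i" unfolding K using fin by (intro Max_ge) auto
      show "v K $ i \<le> v k $ i" using incseqD[OF inc that] .
    qed
    then show ?thesis by blast
  qed auto
  then have "\<forall>i. \<exists>K. i \<notin> \<beta> \<longrightarrow> (\<forall>k\<ge>K. v k $ i = v K $ i)" by blast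
  from choice[OF this] obtain \<kappa> where "\<forall>i. i \<notin> \<beta> \<longrightarrow> (\<forall>k\<ge>\<kappa> i. v k $ i = v (\<kappa> i) $ i)" ..
  then have \<kappa>: "v k $ i = v (\<kappa> i) $ i" if "i \<notin> \<beta>" "k \<ge> \<kappa> i" for i k using that by blast
  define K where "K = Max (range \<kappa>)"
  have le_K: "\<kappa> i \<le> K" for i unfolding K_def by (intro Max_ge) auto
  have const: "v k $ i = v K $ i" if "k \<ge> K" "i \<notin> \<beta>" for k i
    using \<kappa>[OF that(2) le_K] \<kappa>[OF that(2) order_trans[OF le_K that(1)]] by simp
  define a where "a = (\<chi> i. if i \<in> \<beta> then 0 else v K $ i)"
  have std: "xpow x \<notin> M" if x: "lies_on x (a, \<beta>)" for x
  proof -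
    obtain y where y: "supp y \<subseteq> \<beta>" "x = a + y" using x by (auto simp: lies_on_def)
    have "\<forall>i. \<exists>k. i \<in> \<beta> \<longrightarrow> y $ i \<le> v k $ i" by (auto simp: \<beta>_def)
    from choice[OF this] obtain \<rho> where "\<forall>i. i \<in> \<beta> \<longrightarrow> y $ i \<le> v (\<rho> i) $ i" ..
    then have \<rho>: "y $ i \<le> v (\<rho> i) $ i" if "i \<in> \<beta>" for i using that by blast
    define k where "k = max K (Max (range \<rho>))"
    have "\<rho> i \<le> Max (range \<rho>)" for i by (intro Max_ge) auto
    then have \<rho>k: "\<rho> i \<le> k" for i unfolding k_def by (simp add: le_max_iff_disj)
    have le: "x $ i \<le> v k $ i" for i
    proof (cases "i \<in> \<beta>")
      case True
      then have "x $ i = y $ i" by (simp add: y(2) a_def)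
      also have "\<dots> \<le> v (\<rho> i) $ i" by (rule \<rho>[OF True])
      also have "\<dots> \<le> v k $ i" by (rule incseqD[OF inc \<rho>k])
      finally show ?thesis .
    next
      case False
      then have "y $ i = 0" using y(1) by (simp add: supp_subset_iff)
      then show ?thesis using False const[of k i] by (simp add: y(2) a_def k_def)
    qed
    have "v k = (v k - x) + x" using le by (simp add: vec_eq_iff)
    then show ?thesis using down[of x "v k - x"] v[of k] by metis
  qed
  have "lies_on a (a, \<beta>)" unfolding lies_on_def by (intro exI[of _ 0]) (simp add: supp_def)
  then have "admissible_pair M (a, \<beta>)"
    using std unfolding admissible_pair_def by (auto simp: supp_def a_def)
  then show ?thesis using const unfolding a_def by blast
qed

text \<open>If the column \<open>j\<close> were outside the span, a functional \<open>z\<close> would vanish on the columns in \<open>\<beta>\<close> but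
  not on it. From the index \<open>K\<close> on, the exponents \<open>v k\<close> move only in the directions of \<open>\<beta>\<close>, so
  \<open>z\<close> is constant on their degrees. These are up to translation the degrees of the points
  \<open>m (g k)\<close>, on which \<open>z\<close> is a nonconstant polynomial in \<open>g k\<close>: it would take one value
  infinitely often.\<close>

lemma moment_exponents_span:
  fixes A :: "int ^ 'n ^ 'd" and g :: "nat \<Rightarrow> nat"
  assumes e: "inj e" "\<And>i. e i > 0" and m: "\<And>t i. m t $ i = (if i \<in> \<tau> then t ^ e i else 0)"
    and deg: "\<And>k. config_degree A (v k) = config_degree A (m (g k)) + b" and g: "inj g"
    and const: "\<And>k i. k \<ge> K \<Longrightarrow> i \<notin> \<beta> \<Longrightarrow> v k $ i = v K $ i"
    and j: "j \<in> \<tau>"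
  shows "column j (real_matrix A) \<in> span ((\<lambda>j. column j (real_matrix A)) ` \<beta>)"
proof (rule ccontr)
  let ?a = "\<lambda>j. column j (real_matrix A)" and ?r = "\<lambda>x :: int ^ 'd. \<chi> i. real_of_int (x $ i)"
  assume "?a j \<notin> span (?a ` \<beta>)"
  obtain y z where yz: "y \<in> span (?a ` \<beta>)" "\<And>w. w \<in> span (?a ` \<beta>) \<Longrightarrow> orthogonal z w" "?a j = y + z"
    using orthogonal_subspace_decomp_exists[of "?a ` \<beta>" "?a j"] by blast
  have "z \<noteq> 0" using yz \<open>?a j \<notin> _\<close> by auto
  then have zj: "z \<bullet> ?a j \<noteq> 0" using yz(2)[OF yz(1)] by (simp add: yz(3) inner_add_right orthogonal_def)
  have z\<beta>: "z \<bullet> ?a i = 0" if "i \<in> \<beta>" for i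
    using yz(2)[of "?a i"] that by (simp add: orthogonal_def span_base)
  have deg_z: "z \<bullet> ?r (config_degree A u) = (\<Sum>i\<in>UNIV. real (u $ i) * (z \<bullet> ?a i))" for u
    by (simp add: real_config_degree inner_sum_right)
  define c where "c i = (if i \<in> \<tau> then z \<bullet> ?a i else 0)" for i
  have eq: "(\<Sum>i\<in>UNIV. c i * real (g k) ^ e i) = z \<bullet> ?r (config_degree A (v K)) - z \<bullet> ?r b" if k: "k \<ge> K" for k
  proof -
    have "(\<Sum>i\<in>UNIV. c i * real (g k) ^ e i) = z \<bullet> ?r (config_degree A (m (g k)))"
      unfolding deg_z by (intro sum.cong) (auto simp: c_def m)
    also have "\<dots> = z \<bullet> ?r (config_degree A (v k)) - z \<bullet> ?r b"
    proof -
      have "?r (config_degree A (v k)) = ?r (config_degree A (m (g k))) + ?r b" by (simp add: deg vec_eq_iff)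
      then show ?thesis by (simp add: inner_add_right)
    qed
    also have "z \<bullet> ?r (config_degree A (v k)) = z \<bullet> ?r (config_degree A (v K))"
      unfolding deg_z
    proof (intro sum.cong refl)
      fix i
      show "real (v k $ i) * (z \<bullet> ?a i) = real (v K $ i) * (z \<bullet> ?a i)"
        using const[OF k, of i] z\<beta>[of i] by (cases "i \<in> \<beta>") simp_all
    qed
    finally show ?thesis .
  qed
  have "finite {t::nat. (\<Sum>i\<in>UNIV. c i * real t ^ e i) = z \<bullet> ?r (config_degree A (v K)) - z \<bullet> ?r b}"
    by (rule moment_curve_finite[where j = j]) (use e j zj in \<open>auto simp: c_def\<close>)
  moreover have "g ` {K..} \<subseteq> {t::nat. (\<Sum>i\<in>UNIV. c i * real t ^ e i) = z \<bullet> ?r (config_degree A (v K)) - z \<bullet> ?r b}"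
    using eq by auto
  ultimately have "finite (g ` {K..})" by (rule finite_subset[rotated])
  then show False using g infinite_Ici[of K] by (metis finite_imageD inj_on_subset subset_UNIV)
qed

lemma circuit_ideal_subset_toric_ideal: "circuit_ideal A \<subseteq> toric_ideal A"
  unfolding circuit_ideal_def toric_ideal_def by (rule ideal.span_mono) (auto simp: circuit_def)

text \<open>Here \<open>v t\<close> stands for an exponent of the initial form of a witness of degree
  \<open>config_degree A (m t) + b\<close>. Along a monotone subsequence the unbounded coordinates span the
  face, and they stay in the type when the admissible pair they define is enlarged to a standard
  one. That pair covers an exponent \<open>v t\<close>, which becomes nonstandard after multiplication by any
  variable off the face; this bounds its type by \<open>\<tau>\<close>. It is circuit-specific because \<open>v t\<close> is
  nonstandard for the toric ideal.\<close>

lemma exponent_on_spanning_pair: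
  fixes A :: "int ^ 'n ^ 'd" and \<omega> :: "real ^ 'n"
  defines "M \<equiv> init_ideal \<omega> (circuit_ideal A) :: ('n, 'k::comm_ring_1) mpoly set"
  assumes mon: "monomial_ideal M"
    and e: "inj e" "\<And>i. e i > 0" and m: "\<And>t i. m t $ i = (if i \<in> \<tau> then t ^ e i else 0)"
    and deg: "\<And>t. config_degree A (v t) = config_degree A (m t) + b"
    and std: "\<And>t. xpow (v t) \<notin> M"
    and out: "\<And>t j. j \<notin> \<tau> \<Longrightarrow> xpow (axis j 1 + v t) \<in> M"
    and tor: "\<And>t. xpow (v t) \<in> (init_ideal \<omega> (toric_ideal A) :: ('n, 'k) mpoly set)"
  shows "\<exists>t u \<beta>. circuit_specific_pair A \<omega> TYPE('k) (u, \<beta>) \<and> type_spans_face A \<tau> \<beta> \<and> lies_on (v t) (u, \<beta>)"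
proof -
  obtain g where g: "strict_mono g" "\<And>i. incseq (\<lambda>k. v (g k) $ i)" using monotone_subsequence[of v] by blast
  have up: "xpow (w + u) \<in> M" if "xpow u \<in> M" for u w
    using that unfolding M_def by (rule monomial_ideal_init_ideal_up)
  obtain \<beta>0 K where K: "\<forall>k\<ge>K. \<forall>i. i \<notin> \<beta>0 \<longrightarrow> v (g k) $ i = v (g K) $ i"
    and adm0: "admissible_pair M (\<chi> i. if i \<in> \<beta>0 then 0 else v (g K) $ i, \<beta>0)" (is "admissible_pair M (?a, _)")
    using unbounded_coordinates_admissible[of M "\<lambda>k. v (g k)", OF up std g(2)] by blast
  obtain u \<beta> where q: "standard_pair M (u, \<beta>)" and ext: "extends (u, \<beta>) (?a, \<beta>0)"
    using admissible_extends_standard[OF adm0] by (metis surj_pair)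
  have adm: "admissible_pair M (u, \<beta>)" using q by (simp add: standard_pair_def)
  have sub0: "\<beta>0 \<subseteq> \<beta>" using ext by (simp add: extends_def)
  have "lies_on (v (g K)) (?a, \<beta>0)"
    unfolding lies_on_def
    by (intro exI[of _ "\<chi> i. if i \<in> \<beta>0 then v (g K) $ i else 0"]) (auto simp: supp_def vec_eq_iff)
  then have on: "lies_on (v (g K)) (u, \<beta>)" by (rule lies_on_extends[OF ext])
  then obtain w where w: "supp w \<subseteq> \<beta>" "v (g K) = u + w" by (auto simp: lies_on_def)
  have sub: "\<beta> \<subseteq> \<tau>"
  proof
    fix j assume "j \<in> \<beta>"
    moreover have "supp (axis j (1::nat)) \<subseteq> {j}" by (auto simp: supp_def axis_def)
    ultimately have "supp (axis j 1 + w) \<subseteq> \<beta>" using w(1) unfolding supp_add by blast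
    then have "lies_on (axis j 1 + v (g K)) (u, \<beta>)"
      unfolding lies_on_def w(2) by (intro exI[of _ "axis j 1 + w"] conjI) (simp_all add: add_ac)
    then have "xpow (axis j 1 + v (g K)) \<notin> M" using adm unfolding admissible_pair_def by blast
    then show "j \<in> \<tau>" using out by blast
  qed
  have "type_spans_face A \<tau> \<beta>"
  proof (rule type_spans_faceI[OF sub])
    fix d assume "d \<in> config_lattice A" "supp d \<subseteq> \<beta>"
    then show "d = 0"
      by (rule admissible_type_lattice_free[OF mon[unfolded M_def] adm[unfolded M_def]])
  next
    fix j assume j: "j \<in> \<tau>"
    have "column j (real_matrix A) \<in> span ((\<lambda>j. column j (real_matrix A)) ` \<beta>0)"
    proof (rule moment_exponents_span[where v = "\<lambda>k. v (g k)" and g = g and K = K and e = e and m = m])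
      show "inj g" by (rule strict_mono_imp_inj_on[OF g(1)])
      show "v (g k) $ i = v (g K) $ i" if "K \<le> k" "i \<notin> \<beta>0" for k i using K that by blast
    qed (rule e m deg j)+
    then show "column j (real_matrix A) \<in> span ((\<lambda>j. column j (real_matrix A)) ` \<beta>)"
      using span_mono[OF image_mono[OF sub0]] by blast
  qed
  moreover have "\<not> standard_pair (init_ideal \<omega> (toric_ideal A) :: ('n, 'k) mpoly set) (u, \<beta>)"
    using on tor[of "g K"] unfolding standard_pair_def admissible_pair_def by blast
  then have "circuit_specific_pair A \<omega> TYPE('k) (u, \<beta>)"
    using q by (simp add: circuit_specific_pair_def M_def)
  ultimately show ?thesis using on by blast
qed

text \<open>Some variable lies off \<open>\<tau>\<close>; it kills \<open>f\<close> modulo the circuit ideal, hence modulo the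
  toric ideal, which is prime and contains no monomial.\<close>

lemma colon_prime_in_toric_ideal:
  assumes "\<tau> \<noteq> UNIV" "witness f P (circuit_ideal A)" "\<And>j. j \<notin> \<tau> \<Longrightarrow> var j \<in> P"
  shows "f \<in> (toric_ideal A :: ('n::finite, 'k::idom) mpoly set)"
proof -
  obtain j where "j \<notin> \<tau>" using assms(1) by blast
  then have "var j * f \<in> toric_ideal A"
    using assms(2,3) circuit_ideal_subset_toric_ideal by (fastforce simp: witness_def colon_def)
  moreover have "var j \<notin> (toric_ideal A :: ('n, 'k) mpoly set)"
    unfolding var_def by (rule xpow_notin_toric_ideal)
  ultimately show ?thesis using prime_toric_ideal[of A, where 'k = 'k] by (auto simp: prime_ideal_def)
qed

theorem theorem4p4:
  fixes A :: "int ^ 'n ^ 'd"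
    and \<tau> :: "'n set"
    and \<omega> :: "real ^ 'n"
    and I\<^sub>A I\<^sub>C P :: "('n, 'k::alg_closed_field) mpoly set"
  defines "I\<^sub>A \<equiv> toric_ideal A"
    and "I\<^sub>C \<equiv> circuit_ideal A"
    and "P \<equiv> ideal_sum (coord_prime \<tau>) (toric_ideal A)"
  assumes "rank (real_matrix A) = CARD('d)"
    and "config_lattice A \<inter> {u. \<forall>i. 0 \<le> u $ i} = {0}"
    and "is_face A \<tau>" and "\<tau> \<noteq> UNIV"
    and "monomial_ideal (init_ideal \<omega> I\<^sub>A)" and "monomial_ideal (init_ideal \<omega> I\<^sub>C)"
    and "associated_prime P I\<^sub>C"
  shows "embedded_prime P I\<^sub>C \<and>
    (\<exists>u \<beta>. circuit_specific_pair A \<omega> TYPE('k) (u, \<beta>) \<and> type_spans_face A \<tau> \<beta>) \<and>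
    (\<exists>f. witness f P I\<^sub>C \<and>
       (\<forall>v \<in> Poly_Mapping.keys (init_form \<omega> f).
          \<exists>u \<beta>. circuit_specific_pair A \<omega> TYPE('k) (u, \<beta>) \<and> type_spans_face A \<tau> \<beta> \<and>
                 lies_on v (u, \<beta>)) \<and>
       ((\<forall>w \<in> config_lattice A - {0}. \<omega> \<bullet> (\<chi> i. real_of_int (w $ i)) \<noteq> 0) \<longrightarrow>
          card (Poly_Mapping.keys (init_form \<omega> f)) = 1))"
proof -
  note lattice = assms(5) and face = assms(6) and proper = assms(7)
    and monA = assms(8) and monC = assms(9) and assoc = assms(10)
  let ?on_pair = "\<lambda>v. \<exists>u \<beta>. circuit_specific_pair A \<omega> TYPE('k) (u, \<beta>) \<and> type_spans_face A \<tau> \<beta> \<and>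
                 lies_on v (u, \<beta>)"
  have I: "ideal.subspace I\<^sub>C" "graded A I\<^sub>C"
    unfolding I\<^sub>C_def using graded_circuit_ideal by (simp_all add: circuit_ideal_def)
  have P: "prime_ideal P" "graded A P"
    using assoc unfolding P_def
    by (auto simp: associated_prime_def intro: graded_ideal_sum graded_coord_prime graded_toric_ideal)
  have zero: "0 \<in> coord_prime \<tau>" "0 \<in> I\<^sub>A"
    by (simp_all add: coord_prime_def I\<^sub>A_def toric_ideal_def ideal.span_zero)
  have A_sub_P: "I\<^sub>A \<subseteq> P" using zero(1) by (force simp: P_def ideal_sum_def I\<^sub>A_def)
  have "var j \<in> (coord_prime \<tau> :: ('n, 'k) mpoly set)" if "j \<notin> \<tau>" for j
    unfolding coord_prime_def using that by (intro ideal.span_base) simp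
  then have varP: "var j \<in> P" if "j \<notin> \<tau>" for j
    using zero(2) that by (force simp: P_def ideal_sum_def I\<^sub>A_def)
  \<comment> \<open>The toric ideal is a prime between the circuit ideal and \<open>P\<close>, and \<open>P\<close> contains a variable.\<close>
  have embedded: "embedded_prime P I\<^sub>C"
  proof -
    obtain j where "j \<notin> \<tau>" using proper by blast
    then have "var j \<in> P - I\<^sub>A" using varP xpow_notin_toric_ideal by (auto simp: var_def I\<^sub>A_def)
    then have "I\<^sub>A \<subset> P" using A_sub_P by blast
    moreover have "prime_ideal I\<^sub>A" unfolding I\<^sub>A_def by (rule prime_toric_ideal)
    moreover have "I\<^sub>C \<subseteq> I\<^sub>A" unfolding I\<^sub>A_def I\<^sub>C_def by (rule circuit_ideal_subset_toric_ideal)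
    ultimately show ?thesis using assoc unfolding embedded_prime_def by blast
  qed
  obtain f0 where "witness f0 P I\<^sub>C" using assoc by (auto simp: associated_prime_def)
  from homogeneous_witness[OF I P(2,1) this] obtain b f where f: "witness f P I\<^sub>C" "homog A b f"
    using homog_part_homog by blast
  obtain e :: "'n \<Rightarrow> nat" where e: "inj e" "\<And>i. e i > 0" using ex_exponents by blast
  \<comment> \<open>The monomials \<open>x^(m t)\<close> lie off \<open>P\<close>, so multiplying by them yields new witnesses, with generic degrees.\<close>
  define m where "m t = (\<chi> i. if i \<in> \<tau> then t ^ e i else 0)" for t :: nat
  have "\<forall>t. \<exists>h. xpow (m t) * f - h \<in> I\<^sub>C \<and> homog A (config_degree A (m t) + b) h \<and>
      (\<forall>v\<in>Poly_Mapping.keys (init_form \<omega> h). xpow v \<notin> init_ideal \<omega> I\<^sub>C)"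
    by (intro allI normal_form[OF I finite_fibre[OF lattice]] homog_mult homog_xpow f(2))
  from choice[OF this] obtain h where h: "\<And>t. xpow (m t) * f - h t \<in> I\<^sub>C"
    "\<And>t. homog A (config_degree A (m t) + b) (h t)"
    "\<And>t v. v \<in> Poly_Mapping.keys (init_form \<omega> (h t)) \<Longrightarrow> xpow v \<notin> init_ideal \<omega> I\<^sub>C" by blast
  have wit: "witness (h t) P I\<^sub>C" for t
  proof (rule witness_congI[OF I(1) witness_mult[OF P(1) f(1)] h(1)])
    show "xpow (m t) \<notin> P"
      unfolding P_def by (rule xpow_notin_face_prime[OF face]) (auto simp: m_def supp_def)
  qed
  have out: "xpow (axis j 1 + v) \<in> init_ideal \<omega> I\<^sub>C"
    if "j \<notin> \<tau>" and v: "v \<in> Poly_Mapping.keys (init_form \<omega> (h t))" for j v t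
  proof -
    have "var j * h t \<in> I\<^sub>C" using varP[OF that(1)] wit[of t] by (auto simp: witness_def colon_def)
    then have "var j * init_form \<omega> (h t) \<in> init_ideal \<omega> I\<^sub>C"
      unfolding init_ideal_def var_def init_form_xpow_mult[symmetric] by (intro ideal.span_base imageI)
    moreover have "axis j 1 + v \<in> Poly_Mapping.keys (var j * init_form \<omega> (h t))"
      using v unfolding var_def keys_xpow_mult by blast
    ultimately show ?thesis using monomial_ideal_iff_keys[OF monC] by blast
  qed
  have tor: "xpow v \<in> init_ideal \<omega> I\<^sub>A" if v: "v \<in> Poly_Mapping.keys (init_form \<omega> (h t))" for v t
  proof -
    have "h t \<in> I\<^sub>A" unfolding I\<^sub>A_def
      by (rule colon_prime_in_toric_ideal[OF proper wit[unfolded I\<^sub>C_def] varP])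
    then have "init_form \<omega> (h t) \<in> init_ideal \<omega> I\<^sub>A"
      unfolding init_ideal_def by (intro ideal.span_base imageI)
    then show ?thesis using v monomial_ideal_iff_keys[OF monA] by blast
  qed
  \<comment> \<open>Otherwise each \<open>t\<close> has a leading exponent on no required pair, although one exponent in any such
     sequence lies on a required pair.\<close>
  have "\<exists>t. \<forall>v\<in>Poly_Mapping.keys (init_form \<omega> (h t)). ?on_pair v"
  proof (rule ccontr)
    assume "\<not> ?thesis"
    then have "\<forall>t. \<exists>v. v \<in> Poly_Mapping.keys (init_form \<omega> (h t)) \<and> \<not> ?on_pair v" by blast
    from choice[OF this] obtain v where v: "\<And>t. v t \<in> Poly_Mapping.keys (init_form \<omega> (h t))"
      "\<And>t. \<not> ?on_pair (v t)" by blast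
    have "\<exists>t. ?on_pair (v t)"
    proof (rule exponent_on_spanning_pair[OF monC[unfolded I\<^sub>C_def] e])
      show "m t $ i = (if i \<in> \<tau> then t ^ e i else 0)" for t i by (simp add: m_def)
      show "config_degree A (v t) = config_degree A (m t) + b" for t
        using v(1)[of t] h(2)[of t] by (auto simp: keys_init_form homog_def)
      show "xpow (v t) \<notin> (init_ideal \<omega> (circuit_ideal A) :: ('n, 'k) mpoly set)" for t
        using h(3)[OF v(1)] by (simp add: I\<^sub>C_def)
      show "xpow (axis j 1 + v t) \<in> (init_ideal \<omega> (circuit_ideal A) :: ('n, 'k) mpoly set)"
        if "j \<notin> \<tau>" for t j
        using out[OF that v(1)] by (simp add: I\<^sub>C_def)
      show "xpow (v t) \<in> (init_ideal \<omega> (toric_ideal A) :: ('n, 'k) mpoly set)" for t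
        using tor[OF v(1)] by (simp add: I\<^sub>A_def)
    qed
    then show False using v(2) by blast
  qed
  then obtain t where t: "\<And>v. v \<in> Poly_Mapping.keys (init_form \<omega> (h t)) \<Longrightarrow> ?on_pair v" by blast
  let ?K = "Poly_Mapping.keys (init_form \<omega> (h t))"
  have "h t \<noteq> 0"
  proof
    assume "h t = 0"
    then have "P = UNIV" using wit[of t] ideal.subspace_0[OF I(1)] by (auto simp: witness_def colon_def)
    then show False using P(1) by (simp add: prime_ideal_def)
  qed
  then obtain v where v: "v \<in> ?K" using keys_init_form_nonempty by blast
  have "card ?K = 1" if gen: "\<forall>w \<in> config_lattice A - {0}. \<omega> \<bullet> (\<chi> i. real_of_int (w $ i)) \<noteq> 0"
  proof -
    \<comment> \<open>Leading exponents have equal degree, as the witness is homogeneous, and equal weight.\<close>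
    have "u = v" if u: "u \<in> ?K" for u
    proof -
      define w where "w = (\<chi> i. int (u $ i) - int (v $ i))"
      have "config_degree A u = config_degree A v" using u v h(2)[of t] by (simp add: keys_init_form homog_def)
      then have "w \<in> config_lattice A" unfolding w_def by (simp only: config_degree_eq_iff)
      moreover have "weight \<omega> u = weight \<omega> v" using u v by (intro antisym) (auto simp: keys_init_form)
      then have "\<omega> \<bullet> (\<chi> i. real_of_int (w $ i)) = 0"
        by (simp add: w_def weight_def inner_vec_def sum_subtractf algebra_simps)
      ultimately have "w = 0" using gen by blast
      then show ?thesis by (simp add: w_def vec_eq_iff)
    qed
    then have "?K = {v}" using v by blast
    then show ?thesis by simp
  qed
  then have "\<exists>f. witness f P I\<^sub>C \<and> (\<forall>v \<in> Poly_Mapping.keys (init_form \<omega> f). ?on_pair v) \<and>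
       ((\<forall>w \<in> config_lattice A - {0}. \<omega> \<bullet> (\<chi> i. real_of_int (w $ i)) \<noteq> 0) \<longrightarrow>
          card (Poly_Mapping.keys (init_form \<omega> f)) = 1)"
    using wit[of t] t by (intro exI[of _ "h t"]) simp
  then show ?thesis using embedded t[OF v] by blast
qed

end
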